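(* Let $w\in\mathfrak S_n$. For integers $q\ge2$ the weight $\mathrm{wt}(w;q,t)$ is a polynomial in $t$ with nonnegative coefficients, taking the form $$\mathrm{wt}(w;q,t)=t^{x}\prod_{i=1}^{\ell(w)}[q]_{t^{q^{y_i}-q^{z_i}}}$$ for some nonnegative integers $x,y_i,z_i$ with $y_i>z_i$ for all $i$, where $\ell(w)$ is the number of inversions of $w$. Furthermore, $$\lim_{t\to1}\mathrm{wt}(w;q,t)=q^{\ell(w)}\quad\text{and}\quad\lim_{q\to1}\mathrm{wt}(w;q,t^{\frac1{q-1}})=t^{\ell(w)}.$$
   Context: Ring: $\hat{\mathbb Q}(\mathbf t)$ is the field of rational functions over $\mathbb Q$ in algebraically independent indeterminates denoted $t^{q^r}$, $r\in\mathbb Z$ ($t=t^{q^0}$; $q$ is a formal symbol). For $f(q)=\sum_rc_rq^r$ write $t^{f(q)}:=\prod_r(t^{q^r})^{c_r}$. The automorphism $\varphi$ sends $t^{q^r}\mapsto t^{q^{r+1}}$, and $F(q,t^{q^m}):=\varphi^mF(q,t)$. Put $n!_{q,t}:=\prod_{i=0}^{n-1}(1-t^{q^n-q^i})$. For integers $q\ge2$ one specializes by reading $t^{q^r}$ as an actual power of the variable $t$; $[q]_u=1+u+\cdots+u^{q-1}$. The permutations $u_\lambda$: for a partition $\lambda$ inside a $k\times(n-k)$ rectangle, $u_\lambda\in\mathfrak S_n$ is the permutation increasing on $\{1,\ldots,k\}$ and on $\{k+1,\ldots,n\}$ with $u_\lambda(i)=\lambda_{k+1-i}+i$ for $i=1,\ldots,k$.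 Weight: $\mathrm{wt}(w;q,t)\in\hat{\mathbb Q}(\mathbf t)$ for $w\in\mathfrak S_n$ is defined recursively: it is $1$ if $n\le1$. Otherwise let $w^{-1}(1)=k+1$ and factor uniquely $w=u_\lambda\cdot a\cdot e\cdot b$ (so $w(i)=u_\lambda(a(i))$ for $i\le k$, etc.) with $\lambda$ inside a $k\times(n-k)$ rectangle, $a\in\mathfrak S_{\{1,\ldots,k\}}\cong\mathfrak S_k$, $e$ the identity on $\{k+1\}$, and $b\in\mathfrak S_{\{k+2,\ldots,n\}}\cong\mathfrak S_{n-k-1}$. Here $\lambda$ has exactly $k$ nonzero parts; let $\hat\lambda=(\lambda_1-1,\ldots,\lambda_k-1)$, inside a $k\times(n-1-k)$ rectangle, so $u_{\hat\lambda}\in\mathfrak S_{n-1}$. Set $$\mathrm{wt}(w;q,t):=t^{q^k-1}\frac{k!_{q,t^q}}{k!_{q,t}}\cdot\mathrm{wt}(u_{\hat\lambda};q,t^q)\,\mathrm{wt}(a;q,t)\,\mathrm{wt}(b;q,t^{q^{k+1}}).$$ Limits: $\lim_{t\to1}F(q,t)$ means specialize to an integer $q\ge2$, then set $t=1$. $\lim_{q\to1}F(q,t^{1/(q-1)})$ means the image of $F$ under the homomorphism sending $t^{q^r-q^s}=t^{q^r}/t^{q^s}\mapsto t^{r-s}\in\mathbb Q(t)$. *)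

theory Defs
  imports
    "HOL-Library.Poly_Mapping"
    "HOL-Computational_Algebra.Polynomial"
    "HOL-Computational_Algebra.Fraction_Field"
    "HOL-Combinatorics.Permutations"
begin

section \<open>Multivariate polynomials over the rationals\<close>

instance fract :: ("{idom, ring_char_0}") field_char_0
proof
  show "inj (of_nat :: nat \<Rightarrow> 'a fract)"
    by (rule injI) (simp add: of_nat_fract eq_fract)
qed

text \<open>\<open>'v qpoly\<close> is \<open>\<rat>[X\<^sub>v : v \<in> 'v]\<close>: finitely supported families of rational
  coefficients indexed by monomials, i.e. by finitely supported exponent vectors.\<close>

type_synonym 'v qpoly = "('v \<Rightarrow>\<^sub>0 nat) \<Rightarrow>\<^sub>0 rat"

definition mon_eval :: "('v \<Rightarrow> 'a) \<Rightarrow> ('v \<Rightarrow>\<^sub>0 nat) \<Rightarrow> 'a::comm_monoid_mult" where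
  "mon_eval x m = (\<Prod>v\<in>Poly_Mapping.keys m. x v ^ Poly_Mapping.lookup m v)"

definition peval :: "('v \<Rightarrow> 'a) \<Rightarrow> 'v qpoly \<Rightarrow> 'a::field_char_0" where
  "peval x p = (\<Sum>m\<in>Poly_Mapping.keys p. of_rat (Poly_Mapping.lookup p m) * mon_eval x m)"

lemma peval_superset:
  assumes "finite S" "Poly_Mapping.keys p \<subseteq> S"
  shows "peval x p = (\<Sum>m\<in>S. of_rat (Poly_Mapping.lookup p m) * mon_eval x m)"
  unfolding peval_def
  by (rule sum.mono_neutral_left) (use assms in \<open>auto simp: in_keys_iff\<close>)

lemma peval_add: "peval x (p + r) = peval x p + peval x r"
proof -
  let ?S = "Poly_Mapping.keys p \<union> Poly_Mapping.keys r"
  have "peval x (p + r) = (\<Sum>m\<in>?S. of_rat (Poly_Mapping.lookup (p + r) m) * mon_eval x m)"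
    by (rule peval_superset) (auto simp: in_keys_iff lookup_add)
  moreover have "peval x p = (\<Sum>m\<in>?S. of_rat (Poly_Mapping.lookup p m) * mon_eval x m)"
    by (rule peval_superset) auto
  moreover have "peval x r = (\<Sum>m\<in>?S. of_rat (Poly_Mapping.lookup r m) * mon_eval x m)"
    by (rule peval_superset) auto
  ultimately show ?thesis
    by (simp add: lookup_add of_rat_add distrib_right sum.distrib)
qed

lemma peval_zero [simp]: "peval x 0 = 0"
  by (simp add: peval_def)

lemma peval_sum: "peval x (sum f S) = (\<Sum>i\<in>S. peval x (f i))"
  by (induction S rule: infinite_finite_induct) (auto simp: peval_add)

lemma peval_single: "peval x (Poly_Mapping.single m c) = of_rat c * mon_eval x m"
  by (cases "c = 0") (auto simp: peval_def)

lemma pm_decomp: "(\<Sum>m\<in>Poly_Mapping.keys p. Poly_Mapping.single m (Poly_Mapping.lookup p m)) = p"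
  by (rule poly_mapping_eqI) (simp add: lookup_sum lookup_single when_def in_keys_iff)

lemma mon_eval_superset:
  assumes "finite S" "Poly_Mapping.keys m \<subseteq> S"
  shows "mon_eval x m = (\<Prod>v\<in>S. x v ^ Poly_Mapping.lookup m v)"
  unfolding mon_eval_def
  by (rule prod.mono_neutral_left) (use assms in \<open>auto simp: in_keys_iff\<close>)

lemma mon_eval_add: "mon_eval x (m + m') = mon_eval x m * mon_eval x m'"
proof -
  let ?S = "Poly_Mapping.keys m \<union> Poly_Mapping.keys m'"
  have "mon_eval x (m + m') = (\<Prod>v\<in>?S. x v ^ Poly_Mapping.lookup (m + m') v)"
    by (rule mon_eval_superset) (auto simp: in_keys_iff lookup_add)
  moreover have "mon_eval x m = (\<Prod>v\<in>?S. x v ^ Poly_Mapping.lookup m v)"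
    by (rule mon_eval_superset) auto
  moreover have "mon_eval x m' = (\<Prod>v\<in>?S. x v ^ Poly_Mapping.lookup m' v)"
    by (rule mon_eval_superset) auto
  ultimately show ?thesis
    by (simp add: lookup_add power_add prod.distrib)
qed

lemma peval_mult: "peval x (p * r) = peval x p * peval x r"
proof -
  let ?s = "\<lambda>p m. Poly_Mapping.single m (Poly_Mapping.lookup p m)"
  have "p * r = (\<Sum>m\<in>Poly_Mapping.keys p. ?s p m) * (\<Sum>m\<in>Poly_Mapping.keys r. ?s r m)"
    by (simp only: pm_decomp)
  also have "\<dots> = (\<Sum>m\<in>Poly_Mapping.keys p. \<Sum>m'\<in>Poly_Mapping.keys r.
      Poly_Mapping.single (m + m') (Poly_Mapping.lookup p m * Poly_Mapping.lookup r m'))"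
    by (simp add: sum_product mult_single)
  finally have "peval x (p * r) = (\<Sum>m\<in>Poly_Mapping.keys p. \<Sum>m'\<in>Poly_Mapping.keys r.
      of_rat (Poly_Mapping.lookup p m) * mon_eval x m *
      (of_rat (Poly_Mapping.lookup r m') * mon_eval x m'))"
    by (simp add: peval_sum peval_single mon_eval_add of_rat_mult mult_ac)
  then show ?thesis
    by (simp add: peval_def sum_product)
qed

lemma peval_const: "peval x (Poly_Mapping.single 0 c) = of_rat c"
  by (simp add: peval_single mon_eval_def)

lemma peval_one [simp]: "peval x 1 = 1"
  using peval_const[of x 1] by simp

lemma peval_var: "peval x (Poly_Mapping.single (Poly_Mapping.single v 1) 1) = x v"
  by (simp add: peval_single mon_eval_def)

lemma peval_diff: "peval x (p - r) = peval x p - peval x r"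
  using peval_add[of x "p - r" r] by (simp add: algebra_simps)

text \<open>\<open>ratsubst x y F G\<close>: \<open>G\<close> is the image of \<open>F\<close> under the \<open>\<rat>\<close>-algebra homomorphism
  \<open>x v \<mapsto> y v\<close>, extended to all fractions having a representation whose denominator is
  not sent to \<open>0\<close>. The homomorphism exists on the subalgebra generated by the \<open>x v\<close>
  iff every polynomial relation among the \<open>x v\<close> holds among the \<open>y v\<close>; then \<open>G\<close> is
  determined by \<open>F\<close> (\<open>ratsubst_unique\<close>). This is checked below for every use made of it.\<close>

definition ratsubst ::
    "('v \<Rightarrow> 'a::field_char_0) \<Rightarrow> ('v \<Rightarrow> 'b::field_char_0) \<Rightarrow> 'a \<Rightarrow> 'b \<Rightarrow> bool" where
  "ratsubst x y F G \<longleftrightarrow> (\<exists>A B. peval x B \<noteq> 0 \<and> peval y B \<noteq> 0 \<and>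
      F = peval x A / peval x B \<and> G = peval y A / peval y B)"

lemma ratsubst_unique:
  assumes rel: "\<And>A. peval x A = 0 \<Longrightarrow> peval y A = 0"
    and "ratsubst x y F G" "ratsubst x y F G'"
  shows "G = G'"
proof -
  obtain A B A' B' where *:
    "peval x B \<noteq> 0" "peval y B \<noteq> 0" "F = peval x A / peval x B" "G = peval y A / peval y B"
    "peval x B' \<noteq> 0" "peval y B' \<noteq> 0" "F = peval x A' / peval x B'" "G' = peval y A' / peval y B'"
    using assms(2,3) unfolding ratsubst_def by metis
  then have "peval x (A * B' - A' * B) = 0"
    by (simp add: peval_diff peval_mult field_simps)
  then have "peval y (A * B' - A' * B) = 0" by (rule rel)
  then have "peval y A * peval y B' = peval y A' * peval y B"
    by (simp add: peval_diff peval_mult)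
  then show ?thesis using * by (simp add: frac_eq_eq)
qed

lemma ratsubst_peval: "ratsubst x y (peval x A) (peval y A)"
  unfolding ratsubst_def by (rule exI[of _ A], rule exI[of _ 1]) simp

lemma ratsubst_of_rat: "ratsubst x y (of_rat c) (of_rat c)"
  using ratsubst_peval[of x y "Poly_Mapping.single 0 c"] by (simp add: peval_const)

lemma ratsubst_one: "ratsubst x y 1 1"
  using ratsubst_peval[of x y 1] by simp

lemma ratsubst_var: "ratsubst x y (x v) (y v)"
  using ratsubst_peval[of x y "Poly_Mapping.single (Poly_Mapping.single v 1) 1"]
  by (simp only: peval_var)

lemma ratsubst_add:
  assumes "ratsubst x y F G" "ratsubst x y F' G'"
  shows "ratsubst x y (F + F') (G + G')"
proof -
  obtain A B A' B' where
    "peval x B \<noteq> 0" "peval y B \<noteq> 0" "F = peval x A / peval x B" "G = peval y A / peval y B"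
    "peval x B' \<noteq> 0" "peval y B' \<noteq> 0" "F' = peval x A' / peval x B'" "G' = peval y A' / peval y B'"
    using assms unfolding ratsubst_def by metis
  then show ?thesis unfolding ratsubst_def
    by (intro exI[of _ "A * B' + A' * B"] exI[of _ "B * B'"])
       (simp add: peval_add peval_mult add_frac_eq)
qed

lemma ratsubst_mult:
  assumes "ratsubst x y F G" "ratsubst x y F' G'"
  shows "ratsubst x y (F * F') (G * G')"
proof -
  obtain A B A' B' where
    "peval x B \<noteq> 0" "peval y B \<noteq> 0" "F = peval x A / peval x B" "G = peval y A / peval y B"
    "peval x B' \<noteq> 0" "peval y B' \<noteq> 0" "F' = peval x A' / peval x B'" "G' = peval y A' / peval y B'"
    using assms unfolding ratsubst_def by metis
  then show ?thesis unfolding ratsubst_def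
    by (intro exI[of _ "A * A'"] exI[of _ "B * B'"]) (simp add: peval_mult)
qed

lemma ratsubst_divide:
  assumes "ratsubst x y F G" "ratsubst x y F' G'" "F' \<noteq> 0" "G' \<noteq> 0"
  shows "ratsubst x y (F / F') (G / G')"
proof -
  obtain A B A' B' where
    "peval x B \<noteq> 0" "peval y B \<noteq> 0" "F = peval x A / peval x B" "G = peval y A / peval y B"
    "peval x B' \<noteq> 0" "peval y B' \<noteq> 0" "F' = peval x A' / peval x B'" "G' = peval y A' / peval y B'"
    using assms unfolding ratsubst_def by metis
  then show ?thesis using assms(3,4) unfolding ratsubst_def
    by (intro exI[of _ "A * B'"] exI[of _ "B * A'"]) (simp add: peval_mult)
qed

lemma ratsubst_sum:
  "(\<And>i. i \<in> S \<Longrightarrow> ratsubst x y (f i) (g i)) \<Longrightarrow> ratsubst x y (sum f S) (sum g S)"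
  using ratsubst_of_rat[of x y 0]
  by (induction S rule: infinite_finite_induct) (auto intro: ratsubst_add)

lemma ratsubst_prod:
  "(\<And>i. i \<in> S \<Longrightarrow> ratsubst x y (f i) (g i)) \<Longrightarrow> ratsubst x y (prod f S) (prod g S)"
  using ratsubst_one[of x y]
  by (induction S rule: infinite_finite_induct) (auto intro: ratsubst_mult)

lemma ratsubst_power: "ratsubst x y F G \<Longrightarrow> ratsubst x y (F ^ n) (G ^ n)"
  using ratsubst_one[of x y] by (induction n) (auto intro: ratsubst_mult)

lemma ratsubst_compose:
  assumes "\<And>v. ratsubst x y (x' v) (y' v)"
  shows "ratsubst x y (peval x' A) (peval y' A)"
  unfolding peval_def mon_eval_def
  by (intro ratsubst_sum ratsubst_mult ratsubst_of_rat ratsubst_prod ratsubst_power assms)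


section \<open>The field of rational functions in the \<open>t\<^bsup>q\<^sup>r\<^esup>\<close>, its automorphism, and specializations\<close>

type_synonym qhat = "int qpoly fract"

text \<open>\<open>T r\<close> is the indeterminate written \<open>t\<^bsup>q\<^sup>r\<^esup>\<close>; thus \<open>t\<^bsup>q\<^sup>r - q\<^sup>s\<^esup>\<close> is \<open>T r / T s\<close>.\<close>

definition T :: "int \<Rightarrow> qhat" where
  "T r = Fract (Poly_Mapping.single (Poly_Mapping.single r 1) 1) 1"

lemma Fract_plus1: "Fract (a + b) 1 = Fract a 1 + Fract b 1"
  and Fract_times1: "Fract (a * b) 1 = Fract a 1 * Fract b 1"
  by simp_all

lemma Fract_sum: "Fract (sum f S) 1 = (\<Sum>i\<in>S. Fract (f i) 1)"
  by (induction S rule: infinite_finite_induct)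
     (auto simp: fract_collapse Fract_plus1 simp del: add_fract)

lemma Fract_power: "Fract (a ^ n) 1 = (Fract a 1) ^ n"
  by (induction n) (auto simp: fract_collapse Fract_times1 simp del: mult_fract)

lemma Fract_prod: "Fract (prod f S) 1 = (\<Prod>i\<in>S. Fract (f i) 1)"
  by (induction S rule: infinite_finite_induct)
     (auto simp: fract_collapse Fract_times1 simp del: mult_fract)

lemma of_rat_Fract_single:
  "of_rat c = Fract (Poly_Mapping.single 0 c :: 'a::{ordered_cancel_comm_monoid_add, linorder} \<Rightarrow>\<^sub>0 rat) 1"
proof (cases c)
  case (Fract a b)
  have *: "Fract (of_int z :: 'a \<Rightarrow>\<^sub>0 rat) 1 = of_int z" for z
  proof (cases z)
    case (nonneg m)
    then show ?thesis by (simp add: of_nat_fract)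
  next
    case (neg m)
    have "Fract (- of_nat (Suc m) :: 'a \<Rightarrow>\<^sub>0 rat) 1 = - of_nat (Suc m)"
      by (simp only: of_nat_fract minus_fract)
    then show ?thesis using neg by (metis of_int_minus of_int_of_nat_eq)
  qed
  have "(of_int b :: 'a \<Rightarrow>\<^sub>0 rat) \<noteq> 0" using Fract by simp
  moreover have "Poly_Mapping.single 0 c * (of_int b :: 'a \<Rightarrow>\<^sub>0 rat) = of_int a"
    using Fract by (simp add: single_of_int[symmetric] mult_single Fract_of_int_quotient del: single_of_int)
  ultimately show ?thesis using Fract
    by (simp add: Fract_of_int_quotient of_rat_divide eq_fract flip: *)
qed

lemma pm_decomp_nat:
  "(\<Sum>v\<in>Poly_Mapping.keys m. Poly_Mapping.single v (Poly_Mapping.lookup m v :: nat)) = m"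
  by (rule poly_mapping_eqI) (simp add: lookup_sum lookup_single when_def in_keys_iff)

lemma single_eq_prod:
  "Poly_Mapping.single m (1::rat) =
     (\<Prod>v\<in>Poly_Mapping.keys m. Poly_Mapping.single (Poly_Mapping.single v 1) 1 ^ Poly_Mapping.lookup m v)"
proof -
  have pow: "Poly_Mapping.single (Poly_Mapping.single v (1::nat)) (1::rat) ^ k
      = Poly_Mapping.single (Poly_Mapping.single v k) 1" for v :: 'a and k
    by (induction k) (auto simp: mult_single single_add[symmetric])
  have "(\<Prod>v\<in>S. Poly_Mapping.single (f v) (1::rat)) = Poly_Mapping.single (sum f S) 1"
    for S and f :: "'a \<Rightarrow> 'a \<Rightarrow>\<^sub>0 nat"
    by (induction S rule: infinite_finite_induct) (auto simp: mult_single)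
  then show ?thesis by (simp only: pow pm_decomp_nat)
qed

lemma peval_T: "peval T A = Fract A 1"
proof -
  have m: "mon_eval T m = Fract (Poly_Mapping.single m 1) 1" for m
    unfolding mon_eval_def T_def by (simp only: Fract_power[symmetric] Fract_prod[symmetric] single_eq_prod[of m])
  have "of_rat c * mon_eval T m = Fract (Poly_Mapping.single m c) 1" for m c
    unfolding m of_rat_Fract_single by (simp add: mult_single)
  then show ?thesis
    unfolding peval_def by (simp add: Fract_sum[symmetric] pm_decomp)
qed

lemma T_independent: "peval T A = 0 \<Longrightarrow> peval y A = 0"
  by (simp add: peval_T Zero_fract_def eq_fract)

lemmas ratsubst_T_unique = ratsubst_unique[of T, OF T_independent]

text \<open>The automorphism \<open>T r \<mapsto> T (r + 1)\<close>, i.e. \<open>F(q,t) \<mapsto> F(q,t\<^sup>q)\<close>.\<close>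

definition phi :: "qhat \<Rightarrow> qhat" where
  "phi F = (THE G. ratsubst T (\<lambda>r. T (r + 1)) F G)"

lemma T_nonzero [simp]: "T r \<noteq> 0"
  by (simp add: T_def Zero_fract_def eq_fract) (metis lookup_single_eq lookup_zero zero_neq_one)

lemma phi_eq: "phi F = G \<longleftrightarrow> ratsubst T (\<lambda>r. T (r + 1)) F G"
proof -
  obtain A B where AB: "F = Fract A B" "B \<noteq> 0" by (cases F)
  have "peval (\<lambda>r. T (r + 1)) B \<noteq> 0"
  proof
    assume 0: "peval (\<lambda>r. T (r + 1)) B = 0"
    have "ratsubst T (\<lambda>r. T (r - 1)) (T (r + 1)) (T r)" for r
      using ratsubst_var[of T "\<lambda>r. T (r - 1)" "r + 1"] by simp
    then have "ratsubst T (\<lambda>r. T (r - 1)) 0 (peval T B)"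
      using ratsubst_compose[of T "\<lambda>r. T (r - 1)" "\<lambda>r. T (r + 1)" T B] 0 by simp
    then have "peval T B = 0"
      using ratsubst_T_unique ratsubst_of_rat[of T "\<lambda>r. T (r - 1)" 0] by fastforce
    then show False using AB by (simp add: peval_T Zero_fract_def eq_fract)
  qed
  moreover have "F = peval T A / peval T B" "peval T B \<noteq> 0"
    using AB by (simp_all add: peval_T Zero_fract_def eq_fract)
  ultimately have "\<exists>G. ratsubst T (\<lambda>r. T (r + 1)) F G"
    unfolding ratsubst_def by blast
  then have "\<exists>!G. ratsubst T (\<lambda>r. T (r + 1)) F G"
    using ratsubst_T_unique by blast
  then have "ratsubst T (\<lambda>r. T (r + 1)) F (phi F)"
    unfolding phi_def by (rule theI')
  then show ?thesis using ratsubst_T_unique by blast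
qed

lemma phi_T: "phi (T r) = T (r + 1)"
  unfolding phi_eq by (rule ratsubst_var)

lemma phi_add: "phi (F + G) = phi F + phi G"
  and phi_mult: "phi (F * G) = phi F * phi G"
  and phi_one: "phi 1 = 1"
  unfolding phi_eq by (rule ratsubst_add ratsubst_mult ratsubst_one; (rule phi_eq[THEN iffD1], rule refl)?)+

text \<open>To read \<open>t\<^bsup>q\<^sup>r\<^esup>\<close>, for an integer \<open>q \<ge> 2\<close> and \<open>r\<close> of either sign, as an actual power of
  the variable \<open>t\<close>, we work in the fraction field of \<open>\<rat>[t\<^sup>a : a \<in> \<rat>]\<close>.\<close>

type_synonym ratpow_field = "(rat \<Rightarrow>\<^sub>0 rat) fract"

definition tpow :: "rat \<Rightarrow> ratpow_field" where
  "tpow a = Fract (Poly_Mapping.single a 1) 1"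

abbreviation tvar :: ratpow_field where
  "tvar \<equiv> tpow 1"

definition specializes :: "nat \<Rightarrow> qhat \<Rightarrow> ratpow_field \<Rightarrow> bool" where
  "specializes q F G \<longleftrightarrow> ratsubst T (\<lambda>r. tpow (of_nat q powi r)) F G"

lemma specializes_unique: "specializes q F G \<Longrightarrow> specializes q F G' \<Longrightarrow> G = G'"
  unfolding specializes_def by (rule ratsubst_T_unique)

text \<open>\<open>lim_t1 q F c\<close>: after specializing to the integer \<open>q\<close>, setting \<open>t = 1\<close> gives \<open>c\<close>.\<close>

definition lim_t1 :: "nat \<Rightarrow> qhat \<Rightarrow> rat \<Rightarrow> bool" where
  "lim_t1 q F c \<longleftrightarrow> (\<exists>G. specializes q F G \<and> ratsubst tpow (\<lambda>a. 1) G c)"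

lemma peval_tpow: "\<exists>p. peval tpow A = Fract p 1 \<and>
    peval (\<lambda>a. 1 :: rat) A = (\<Sum>a\<in>Poly_Mapping.keys p. Poly_Mapping.lookup p a)"
proof -
  define aug :: "(rat \<Rightarrow>\<^sub>0 rat) \<Rightarrow> rat" where
    "aug p = (\<Sum>a\<in>Poly_Mapping.keys p. Poly_Mapping.lookup p a)" for p
  have aug_superset: "aug p = (\<Sum>a\<in>S. Poly_Mapping.lookup p a)"
    if "finite S" "Poly_Mapping.keys p \<subseteq> S" for p S
    unfolding aug_def by (rule sum.mono_neutral_left) (use that in \<open>auto simp: in_keys_iff\<close>)
  have aug_add: "aug (p + r) = aug p + aug r" for p r
  proof -
    let ?S = "Poly_Mapping.keys p \<union> Poly_Mapping.keys r"
    have "Poly_Mapping.keys (p + r) \<subseteq> ?S" by (rule keys_add)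
    then show ?thesis
      using aug_superset[of ?S p] aug_superset[of ?S r] aug_superset[of ?S "p + r"]
      by (simp add: lookup_add sum.distrib)
  qed
  have aug_sum: "aug (sum f S) = (\<Sum>i\<in>S. aug (f i))" for f and S :: "(rat \<Rightarrow>\<^sub>0 nat) set"
    by (induction S rule: infinite_finite_induct) (auto simp: aug_add, auto simp: aug_def)
  have aug_single: "aug (Poly_Mapping.single a c) = c" for a c
    by (cases "c = 0") (auto simp: aug_def)
  have pow: "tpow a ^ k = tpow (of_nat k * a)" for a k
    by (induction k) (auto simp: tpow_def mult_single One_fract_def algebra_simps)
  have prod: "(\<Prod>v\<in>S. tpow (f v)) = tpow (sum f S)" for f and S :: "rat set"
    by (induction S rule: infinite_finite_induct) (auto simp: tpow_def mult_single One_fract_def)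
  define e :: "(rat \<Rightarrow>\<^sub>0 nat) \<Rightarrow> rat"
    where "e m = (\<Sum>v\<in>Poly_Mapping.keys m. of_nat (Poly_Mapping.lookup m v) * v)" for m
  have e: "mon_eval tpow m = tpow (e m)" for m
    unfolding mon_eval_def pow prod e_def ..
  let ?p = "\<Sum>m\<in>Poly_Mapping.keys A. Poly_Mapping.single (e m) (Poly_Mapping.lookup A m)"
  have "peval tpow A = Fract ?p 1"
    unfolding peval_def e tpow_def Fract_sum of_rat_Fract_single by (simp add: mult_single)
  moreover have "peval (\<lambda>a. 1 :: rat) A = aug ?p"
    by (simp add: peval_def mon_eval_def aug_sum aug_single)
  ultimately show ?thesis unfolding aug_def by blast
qed

lemma lim_t1_unique: "lim_t1 q F c \<Longrightarrow> lim_t1 q F c' \<Longrightarrow> c = c'"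
proof -
  have "peval (\<lambda>a. 1 :: rat) A = 0" if "peval tpow A = 0" for A
    using peval_tpow[of A] that by (auto simp: Zero_fract_def eq_fract)
  from ratsubst_unique[of tpow, OF this]
  show "lim_t1 q F c \<Longrightarrow> lim_t1 q F c' \<Longrightarrow> c = c'"
    unfolding lim_t1_def using specializes_unique by blast
qed

text \<open>\<open>lim_q1 F G\<close>: the limit as \<open>q \<rightarrow> 1\<close> of \<open>F(q,t\<^bsup>1/(q-1)\<^esup>)\<close> is \<open>G\<close>, i.e. \<open>G\<close> is the image
  of \<open>F\<close> under \<open>t\<^bsup>q\<^sup>r - q\<^sup>s\<^esup> \<mapsto> t\<^bsup>r - s\<^esup> \<in> \<rat>(t)\<close>.\<close>

abbreviation qt_var :: "rat poly fract" where
  "qt_var \<equiv> Fract [:0, 1:] 1"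

definition lim_q1 :: "qhat \<Rightarrow> rat poly fract \<Rightarrow> bool" where
  "lim_q1 F G \<longleftrightarrow> ratsubst (\<lambda>(r, s). T r / T s) (\<lambda>(r, s). qt_var powi (r - s)) F G"

lemma lim_q1_unique: "lim_q1 F G \<Longrightarrow> lim_q1 F G' \<Longrightarrow> G = G'"
  unfolding lim_q1_def
proof (rule ratsubst_unique)
  fix A :: "(int \<times> int) qpoly"
  assume 0: "peval (\<lambda>(r, s). T r / T s) A = 0"
  let ?y = "\<lambda>r :: int. qt_var powi r"
  have nz: "qt_var \<noteq> 0" by (simp add: Zero_fract_def eq_fract)
  have "ratsubst T ?y (case v of (r, s) \<Rightarrow> T r / T s)
      (case v of (r, s) \<Rightarrow> qt_var powi (r - s))" for v
    using ratsubst_divide[OF ratsubst_var[of T ?y "fst v"] ratsubst_var[of T ?y "snd v"]] nz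
    by (simp add: case_prod_beta power_int_diff)
  from ratsubst_compose[of T ?y "\<lambda>(r, s). T r / T s" "\<lambda>(r, s). qt_var powi (r - s)", OF this, of A]
  show "peval (\<lambda>(r, s). qt_var powi (r - s)) A = 0"
    using 0 ratsubst_of_rat[of T ?y 0] ratsubst_T_unique by fastforce
qed

text \<open>\<open>[q]\<^sub>u\<close>\<close>

definition qint :: "nat \<Rightarrow> 'a \<Rightarrow> 'a::comm_semiring_1" where
  "qint q u = (\<Sum>j<q. u ^ j)"

text \<open>\<open>n!\<^bsub>q,t\<^esub>\<close>\<close>

definition qtfact :: "nat \<Rightarrow> qhat" where
  "qtfact n = (\<Prod>i<n. 1 - T (int n) / T (int i))"


section \<open>Partitions, permutations and the weight\<close>

text \<open>A partition inside a \<open>k \<times> m\<close> rectangle is a function \<open>lam\<close> with \<open>lam i = \<lambda>\<^sub>i\<close> for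
  \<open>1 \<le> i \<le> k\<close> and \<open>0\<close> elsewhere.\<close>

definition partition_in_rect :: "nat \<Rightarrow> nat \<Rightarrow> (nat \<Rightarrow> nat) \<Rightarrow> bool" where
  "partition_in_rect k m lam \<longleftrightarrow>
     (\<forall>i. i \<notin> {1..k} \<longrightarrow> lam i = 0) \<and> (\<forall>i\<in>{1..k}. lam i \<le> m) \<and>
     (\<forall>i\<in>{1..k}. \<forall>j\<in>{1..k}. i \<le> j \<longrightarrow> lam j \<le> lam i)"

definition u_perm :: "nat \<Rightarrow> nat \<Rightarrow> (nat \<Rightarrow> nat) \<Rightarrow> nat \<Rightarrow> nat" where
  "u_perm n k lam = (THE u. u permutes {1..n} \<and>
     strict_mono_on {1..k} u \<and> strict_mono_on {k+1..n} u \<and>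
     (\<forall>i\<in>{1..k}. u i = lam (k + 1 - i) + i))"

definition factors :: "nat \<Rightarrow> nat \<Rightarrow> (nat \<Rightarrow> nat) \<Rightarrow>
    (nat \<Rightarrow> nat) \<times> (nat \<Rightarrow> nat) \<times> (nat \<Rightarrow> nat) \<Rightarrow> bool" where
  "factors n k w = (\<lambda>(lam, a, b). partition_in_rect k (n - k) lam \<and>
     a permutes {1..k} \<and> b permutes {k+2..n} \<and> w = u_perm n k lam \<circ> a \<circ> b)"

text \<open>The identification of \<open>\<SS>\<^bsub>{d+1,\<dots>,d+m}\<^esub>\<close> with \<open>\<SS>\<^sub>m\<close>.\<close>

definition unshift :: "nat \<Rightarrow> (nat \<Rightarrow> nat) \<Rightarrow> nat \<Rightarrow> nat" where
  "unshift d b = (\<lambda>i. b (i + d) - d)"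

text \<open>\<open>wt n w\<close> is the weight of \<open>w \<in> \<SS>\<^sub>n\<close>; the value \<open>0\<close> for \<open>w \<notin> \<SS>\<^sub>n\<close> is a dummy that
  makes the function total.\<close>

function wt :: "nat \<Rightarrow> (nat \<Rightarrow> nat) \<Rightarrow> qhat" where
  "wt n w =
    (if \<not> w permutes {1..n} then 0
     else if n \<le> 1 then 1
     else let k = inv w 1 - 1;
              (lam, a, b) = (THE f. factors n k w f)
          in (T (int k) / T 0) * (phi (qtfact k) / qtfact k)
             * phi (wt (n - 1) (u_perm (n - 1) k (\<lambda>i. lam i - 1)))
             * wt k a
             * (phi ^^ (k + 1)) (wt (n - k - 1) (unshift (k + 1) b)))"
  by pat_completeness auto
termination
proof (relation "measure fst", goal_cases)
  case (3 n w)
  then have "inv w 1 \<in> {1..n}"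
    using permutes_in_image[OF permutes_inv, of w "{1..n}" 1] by simp
  then show ?case using 3 by auto
qed auto

declare wt.simps [simp del]

definition inv_count :: "nat \<Rightarrow> (nat \<Rightarrow> nat) \<Rightarrow> nat" where
  "inv_count n w = card {(i, j). i \<in> {1..n} \<and> j \<in> {1..n} \<and> i < j \<and> w j < w i}"

end

theory Submission
  imports Defs "HOL-Library.Infinite_Set"
begin

text \<open>Every weight is a product of monomials \<open>T y / T z\<close> and of quotients
  \<open>(1 - T (y + 1) / T (z + 1)) / (1 - T y / T z)\<close>, called \<open>twisted_qint y z\<close> below.  Indeed
  \<open>phi (qtfact k) / qtfact k\<close> is the product of \<open>twisted_qint k i\<close> over \<open>i < k\<close>, and \<open>phi\<close> merely
  raises all indices by one.  The predicate \<open>weight_form m l F\<close> expresses such a factorization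
  with \<open>l\<close> quotients and total index difference \<open>m\<close> in the monomials; it is compatible with
  products and with \<open>phi\<close>.

  For an integer \<open>q \<ge> 2\<close> the quotient specializes to \<open>(1 - u ^ q) / (1 - u)\<close> with
  \<open>u = t ^ (q ^ y - q ^ z)\<close>, a \<open>q\<close>-integer, while a monomial specializes to a power of \<open>t\<close>.  This is
  the product formula with \<open>l\<close> factors (\<open>specializes_weight_form\<close>); nonnegativity of the
  coefficients and the value \<open>q ^ l\<close> at \<open>t = 1\<close> are read off from it.  As \<open>q \<rightarrow> 1\<close>, the numerator
  and the denominator of each quotient have the same image, so only the monomials remain and the
  limit is \<open>t ^ m\<close> (\<open>lim_q1_weight_form\<close>).

  It remains to see that \<open>m\<close> and \<open>l\<close> are both the number of inversions (\<open>weight_form_wt\<close>).  In the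
  recursion both grow by \<open>k\<close>, the number of positions before the value \<open>1\<close>.  If \<open>w = u \<circ> a \<circ> b\<close> with
  \<open>u\<close> Grassmannian, then \<open>k\<close> inversions of \<open>w\<close> involve the value \<open>1\<close>, those inside the two blocks are
  the inversions of \<open>a\<close> and of \<open>b\<close>, and those across are the inversions of \<open>u\<close> with the value \<open>1\<close>
  erased (\<open>inv_count_decomposition\<close>).  Erasing the value \<open>1\<close> from \<open>u\<close> gives the Grassmannian
  permutation of the partition with its first column removed
  (\<open>u_perm_delete_value_one\<close>), which is the permutation entering the recursion.\<close>

section \<open>Products of twisted \<open>q\<close>-integers and monomials\<close>

lemma phi_zero: "phi 0 = 0"
  using phi_add[of 0 0] by simp

lemma phi_diff: "phi (F - G) = phi F - phi G"
  using phi_add[of "F - G" G] by (simp add: algebra_simps)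

lemma phi_nonzero: "phi G \<noteq> 0" if "G \<noteq> 0"
proof
  assume "phi G = 0"
  moreover have "phi G * phi (1 / G) = 1"
    using phi_mult[of G "1 / G"] that by (simp add: phi_one)
  ultimately show False by simp
qed

lemma phi_divide: "phi (F / G) = phi F / phi G"
proof (cases "G = 0")
  case True
  then show ?thesis by (simp add: phi_zero)
next
  case False
  then have "phi F = phi (F / G) * phi G"
    by (simp flip: phi_mult)
  then show ?thesis
    using phi_nonzero[OF False] by (simp add: field_simps)
qed

lemma phi_prod: "phi (prod f S) = (\<Prod>i\<in>S. phi (f i))"
  by (induction S rule: infinite_finite_induct) (auto simp: phi_one phi_mult)

text \<open>Under \<open>t\<^bsup>q\<^sup>r\<^esup> = t ^ (q ^ r)\<close> for an integer \<open>q\<close>, the numerator becomes \<open>1 - u ^ q\<close> for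
  \<open>u = t ^ (q ^ y - q ^ z)\<close>, so this is the element of the big field that specializes to
  the \<open>q\<close>-integer of base \<open>u\<close>.\<close>

definition twisted_qint :: "nat \<Rightarrow> nat \<Rightarrow> qhat" where
  "twisted_qint y z =
     (1 - T (int (Suc y)) / T (int (Suc z))) / (1 - T (int y) / T (int z))"

lemma phi_T_ratio: "phi (T (int y) / T (int z)) = T (int (Suc y)) / T (int (Suc z))"
  by (simp add: phi_divide phi_T add.commute)

lemma phi_twisted_qint: "phi (twisted_qint y z) = twisted_qint (Suc y) (Suc z)"
  by (simp only: twisted_qint_def phi_divide[of "1 - _"] phi_diff phi_one phi_T_ratio)

lemma phi_qtfact_ratio: "phi (qtfact k) / qtfact k = (\<Prod>i<k. twisted_qint k i)"
  by (simp only: qtfact_def phi_prod phi_diff phi_one phi_T_ratio twisted_qint_def prod_dividef)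

lemma ratsubst_diff:
  assumes "ratsubst x y F G" "ratsubst x y F' G'"
  shows "ratsubst x y (F - F') (G - G')"
  using ratsubst_add[OF assms(1) ratsubst_mult[OF ratsubst_of_rat[of x y "- 1"] assms(2)]]
  by (simp add: of_rat_minus)

text \<open>The two counters are what the two limits see: \<open>l\<close> counts the factors \<open>twisted_qint\<close>, each of
  which becomes \<open>q\<close> at \<open>t = 1\<close> and \<open>1\<close> as \<open>q \<rightarrow> 1\<close>; \<open>m\<close> adds up the differences \<open>y - z\<close> of the
  monomials \<open>T y / T z\<close>, each of which becomes \<open>1\<close> at \<open>t = 1\<close> and \<open>t\<^bsup>y - z\<^esup>\<close> as \<open>q \<rightarrow> 1\<close>.  Restricting
  the indices to \<open>nat\<close> with \<open>z \<le> y\<close> makes the specialized exponents nonnegative integers.\<close>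

inductive weight_form :: "nat \<Rightarrow> nat \<Rightarrow> qhat \<Rightarrow> bool" where
  one: "weight_form 0 0 1"
| T_ratio: "weight_form m l F \<Longrightarrow> z \<le> y \<Longrightarrow>
    weight_form (m + (y - z)) l (F * (T (int y) / T (int z)))"
| twisted: "weight_form m l F \<Longrightarrow> z < y \<Longrightarrow> weight_form m (Suc l) (F * twisted_qint y z)"

lemma weight_form_mult:
  assumes "weight_form m' l' F'" "weight_form m l F"
  shows "weight_form (m + m') (l + l') (F * F')"
  using assms(1)
proof induction
  case one
  then show ?case using assms(2) by simp
next
  case (T_ratio m' l' F' z y)
  then show ?case
    using weight_form.T_ratio[OF T_ratio.IH T_ratio.hyps(2)] by (simp only: add.assoc mult.assoc)
next
  case (twisted m' l' F' z y)
  then show ?case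
    using weight_form.twisted[OF twisted.IH twisted.hyps(2)]
    by (simp only: add_Suc_right mult.assoc)
qed

lemma weight_form_phi: "weight_form m l F \<Longrightarrow> weight_form m l (phi F)"
proof (induction rule: weight_form.induct)
  case one
  then show ?case by (simp add: phi_one weight_form.one)
next
  case (T_ratio m l F z y)
  then show ?case
    using weight_form.T_ratio[of m l "phi F" "Suc z" "Suc y"] by (simp only: phi_mult phi_T_ratio) simp
next
  case (twisted m l F z y)
  then show ?case
    using weight_form.twisted[of m l "phi F" "Suc z" "Suc y"] by (simp add: phi_mult phi_twisted_qint)
qed

lemma weight_form_phi_funpow: "weight_form m l F \<Longrightarrow> weight_form m l ((phi ^^ j) F)"
  by (induction j) (auto intro: weight_form_phi)

text \<open>This is the new factor contributed by one step of the recursion for the weight.  The quotient of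
  the two twisted factorials is a product of \<open>k\<close> twisted \<open>q\<close>-integers, and the monomial has
  index difference \<open>k\<close>; thus both counters grow by the same \<open>k\<close>.\<close>

lemma weight_form_step: "weight_form k k (T (int k) / T 0 * (phi (qtfact k) / qtfact k))"
proof -
  have "weight_form k j (T (int k) / T 0 * (\<Prod>i<j. twisted_qint k i))" if "j \<le> k" for j
    using that
  proof (induction j)
    case 0
    show ?case using weight_form.T_ratio[OF weight_form.one, of 0 k] by simp
  next
    case (Suc j)
    then have "weight_form k (Suc j) (T (int k) / T 0 * (\<Prod>i<j. twisted_qint k i) * twisted_qint k j)"
      by (intro weight_form.twisted) auto
    then show ?case by (simp only: prod.lessThan_Suc mult.assoc)
  qed
  from this[of k] show ?thesis by (simp add: phi_qtfact_ratio)
qed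

section \<open>The limit as \<open>q\<close> tends to 1\<close>

lemma single_1_eq_iff: "Poly_Mapping.single a (1 :: 'a :: zero_neq_one) = Poly_Mapping.single b 1 \<longleftrightarrow> a = b"
  by (metis lookup_single_eq lookup_single_not_eq zero_neq_one)

lemma T_ratio_neq_1: "1 - T (int y) / T (int z) \<noteq> 0" if "z < y"
proof
  assume "1 - T (int y) / T (int z) = 0"
  then have "T (int y) = T (int z)" by simp
  then show False using that
    by (auto simp: T_def eq_fract single_1_eq_iff single_1_eq_iff[where 'a = nat, simplified])
qed

lemma qt_var_power_neq_1: "1 - qt_var ^ Suc d \<noteq> 0"
proof
  assume "1 - qt_var ^ Suc d = 0"
  then have "qt_var ^ Suc d = 1" by simp
  then have "[:0, 1:] ^ Suc d = (1 :: rat poly)"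
    by (simp only: Fract_power[symmetric]) (simp add: One_fract_def eq_fract)
  then have "poly ([:0, 1:] ^ Suc d) 0 = (1 :: rat)" by simp
  then show False by simp
qed

text \<open>As \<open>q \<rightarrow> 1\<close> both \<open>T (y + 1) / T (z + 1)\<close> and \<open>T y / T z\<close> become \<open>t\<^bsup>y - z\<^esup>\<close>, because only the
  difference of the indices matters; hence numerator and denominator of \<open>twisted_qint y z\<close> have
  the same nonzero image and only the monomials survive.\<close>

lemma lim_q1_weight_form: "weight_form m l F \<Longrightarrow> lim_q1 F (qt_var ^ m)"
proof (induction rule: weight_form.induct)
  case one
  then show ?case by (simp add: lim_q1_def ratsubst_one)
next
  case (T_ratio m l F z y)
  have "lim_q1 (T (int y) / T (int z)) (qt_var ^ (y - z))"
    unfolding lim_q1_def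
    using ratsubst_var[of "\<lambda>(r, s). T r / T s" "\<lambda>(r, s). qt_var powi (r - s)" "(int y, int z)"]
      T_ratio.hyps by (simp flip: of_nat_diff)
  then show ?case
    using T_ratio.IH unfolding lim_q1_def power_add by (intro ratsubst_mult)
next
  case (twisted m l F z y)
  obtain d where d: "y - z = Suc d" using twisted.hyps by (metis Suc_diff_Suc)
  have *: "lim_q1 (1 - T r / T s) (1 - qt_var ^ Suc d)" if "r - s = int (Suc d)" for r s
  proof -
    have "qt_var powi (r - s) = qt_var ^ Suc d" using that by (simp only: power_int_of_nat)
    then show ?thesis
      using ratsubst_diff[OF ratsubst_one
          ratsubst_var[of "\<lambda>(r, s). T r / T s" "\<lambda>(r, s). qt_var powi (r - s)" "(r, s)"]]
      by (simp add: lim_q1_def)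
  qed
  have "lim_q1 (twisted_qint y z) ((1 - qt_var ^ Suc d) / (1 - qt_var ^ Suc d))"
    unfolding twisted_qint_def lim_q1_def
    by (intro ratsubst_divide *[unfolded lim_q1_def] T_ratio_neq_1 qt_var_power_neq_1)
       (use d twisted.hyps in auto)
  then have "lim_q1 (twisted_qint y z) 1"
    by (simp only: divide_self[OF qt_var_power_neq_1])
  then have "lim_q1 (F * twisted_qint y z) (qt_var ^ m * 1)"
    using twisted.IH unfolding lim_q1_def by (intro ratsubst_mult)
  then show ?case by (simp only: mult_1_right)
qed


section \<open>Specialization at an integer \<open>q\<close>\<close>

lemma tpow_nonzero: "tpow b \<noteq> 0"
  by (simp add: tpow_def Zero_fract_def eq_fract) (metis lookup_single_eq lookup_zero zero_neq_one)

lemma tpow_divide: "tpow a / tpow b = tpow (a - b)"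
proof -
  have "tpow (a - b) * tpow b = tpow a" by (simp add: tpow_def mult_single)
  then show ?thesis using tpow_nonzero[of b] by (simp add: field_simps)
qed

lemma tpow_power: "tpow a ^ k = tpow (of_nat k * a)"
  by (induction k) (auto simp: tpow_def mult_single One_fract_def algebra_simps)

lemma tpow_eq_iff: "tpow a = tpow b \<longleftrightarrow> a = b"
  by (simp add: tpow_def eq_fract single_1_eq_iff)

lemma specializes_T_ratio:
  assumes "q \<ge> 2" "z \<le> y"
  shows "specializes q (T (int y) / T (int z)) (tvar ^ (q ^ y - q ^ z))"
proof -
  have "q ^ z \<le> q ^ y" using assms by (intro power_increasing) auto
  then have "tvar ^ (q ^ y - q ^ z) = tpow (of_nat q powi int y) / tpow (of_nat q powi int z)"
    by (simp add: tpow_divide tpow_power of_nat_diff)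
  then show ?thesis
    unfolding specializes_def
    by (simp only:) (intro ratsubst_divide ratsubst_var T_nonzero tpow_nonzero)
qed

text \<open>The exponent identity \<open>q ^ (y + 1) - q ^ (z + 1) = (q ^ y - q ^ z) * q\<close> turns the quotient into
  \<open>(1 - u ^ q) / (1 - u)\<close>, a geometric sum.  The hypothesis \<open>q \<ge> 2\<close> makes
  \<open>q ^ y \<noteq> q ^ z\<close>, so that the denominator stays nonzero.\<close>

lemma specializes_twisted_qint:
  assumes "q \<ge> 2" "z < y"
  shows "specializes q (twisted_qint y z) (qint q (tvar ^ (q ^ y - q ^ z)))"
proof -
  let ?u = "tvar ^ (q ^ y - q ^ z)"
  have less: "q ^ z < q ^ y" using assms by (intro power_strict_increasing) auto
  have "tpow 0 = 1" by (simp add: tpow_def One_fract_def)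
  then have neq: "1 - ?u \<noteq> 0"
    using tpow_eq_iff[of "of_nat (q ^ y - q ^ z)" 0] less
    by (simp only: tpow_power of_nat_eq_0_iff mult_1_right) auto
  have "q ^ Suc y - q ^ Suc z = (q ^ y - q ^ z) * q"
    by (simp add: diff_mult_distrib2 mult.commute)
  then have "tvar ^ (q ^ Suc y - q ^ Suc z) = ?u ^ q"
    by (simp only: power_mult)
  moreover have "qint q ?u = (1 - ?u ^ q) / (1 - ?u)"
    using neq by (simp add: qint_def sum_gp_strict)
  ultimately have "qint q ?u = (1 - tvar ^ (q ^ Suc y - q ^ Suc z)) / (1 - ?u)" by simp
  then show ?thesis
    using specializes_T_ratio[of q "Suc z" "Suc y"] specializes_T_ratio[of q z y] assms neq
    unfolding specializes_def twisted_qint_def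
    by (simp only:) (intro ratsubst_divide ratsubst_diff ratsubst_one T_ratio_neq_1; simp)
qed

text \<open>Evaluation at \<open>tvar\<close> is a ring homomorphism into the field of fractional powers; this lets the
  product formula be manipulated as an identity of ordinary polynomials.\<close>

definition at_tvar :: "rat poly \<Rightarrow> ratpow_field" where
  "at_tvar P = poly (map_poly of_rat P) tvar"

lemma at_tvar_pCons: "at_tvar (pCons c P) = of_rat c + tvar * at_tvar P"
  by (simp add: at_tvar_def map_poly_pCons)

lemma at_tvar_0: "at_tvar 0 = 0"
  by (simp add: at_tvar_def)

lemma at_tvar_add: "at_tvar (P + R) = at_tvar P + at_tvar R"
  by (induction P R rule: poly_induct2) (auto simp: at_tvar_0 at_tvar_pCons of_rat_add algebra_simps)

lemma at_tvar_smult: "at_tvar (smult c P) = of_rat c * at_tvar P"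
  by (induction P) (auto simp: at_tvar_0 at_tvar_pCons of_rat_mult algebra_simps)

lemma at_tvar_mult: "at_tvar (P * R) = at_tvar P * at_tvar R"
  by (induction P) (auto simp: at_tvar_0 at_tvar_pCons at_tvar_add at_tvar_smult algebra_simps)

lemma at_tvar_monom: "at_tvar (monom 1 k) = tvar ^ k"
  by (simp add: at_tvar_def map_poly_monom poly_monom)

lemma at_tvar_1: "at_tvar 1 = 1"
  by (simp add: at_tvar_def)

lemma at_tvar_power: "at_tvar (P ^ k) = at_tvar P ^ k"
  by (induction k) (auto simp: at_tvar_1 at_tvar_mult)

lemma at_tvar_qint: "at_tvar (qint q P) = qint q (at_tvar P)"
proof -
  have "at_tvar (\<Sum>j<n. P ^ j) = (\<Sum>j<n. at_tvar P ^ j)" for n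
    by (induction n) (auto simp: at_tvar_0 at_tvar_add at_tvar_power)
  then show ?thesis by (simp add: qint_def)
qed

text \<open>Once the specialization is known to be a polynomial, setting \<open>t = 1\<close> is evaluation at \<open>1\<close>.\<close>

lemma ratsubst_at_tvar_1: "ratsubst tpow (\<lambda>a. 1) (at_tvar P) (poly P 1)"
proof (induction P)
  case 0
  then show ?case using ratsubst_of_rat[of tpow "\<lambda>_. 1 :: rat" 0] by (simp add: at_tvar_0)
next
  case (pCons c P)
  then show ?case
    using ratsubst_add[OF ratsubst_of_rat[of tpow "\<lambda>_. 1 :: rat" c]
        ratsubst_mult[OF ratsubst_var[of tpow "\<lambda>_. 1 :: rat" 1] pCons.IH]]
    by (simp add: at_tvar_pCons)
qed

lemma specializes_weight_form:
  assumes "q \<ge> 2"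
  shows "weight_form m l F \<Longrightarrow> \<exists>(x :: nat) (y :: nat \<Rightarrow> nat) (z :: nat \<Rightarrow> nat).
      (\<forall>i\<in>{1..l}. z i < y i) \<and>
      specializes q F (at_tvar (monom 1 x * (\<Prod>i=1..l. qint q (monom 1 (q ^ y i - q ^ z i)))))"
proof (induction rule: weight_form.induct)
  case one
  show ?case
    by (rule exI[of _ 0]) (simp add: specializes_def at_tvar_1 ratsubst_one)
next
  case (T_ratio m l F b a)
  then obtain x y z where *: "\<forall>i\<in>{1..l}. z i < y i"
    "specializes q F (at_tvar (monom 1 x * (\<Prod>i=1..l. qint q (monom 1 (q ^ y i - q ^ z i)))))"
    by blast
  have "at_tvar (monom 1 (x + (q ^ a - q ^ b)) * R) = at_tvar (monom 1 x * R) * tvar ^ (q ^ a - q ^ b)" for R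
    by (simp add: at_tvar_mult at_tvar_monom power_add)
  then have "specializes q (F * (T (int a) / T (int b)))
      (at_tvar (monom 1 (x + (q ^ a - q ^ b)) * (\<Prod>i=1..l. qint q (monom 1 (q ^ y i - q ^ z i)))))"
    using ratsubst_mult[OF *(2)[unfolded specializes_def]
        specializes_T_ratio[OF assms T_ratio.hyps(2), unfolded specializes_def]]
    by (simp add: specializes_def)
  with *(1) show ?case by blast
next
  case (twisted m l F b a)
  then obtain x y z where *: "\<forall>i\<in>{1..l}. z i < y i"
    "specializes q F (at_tvar (monom 1 x * (\<Prod>i=1..l. qint q (monom 1 (q ^ y i - q ^ z i)))))"
    by blast
  let ?y = "y(Suc l := a)" and ?z = "z(Suc l := b)"
  have "(\<Prod>i=1..Suc l. qint q (monom 1 (q ^ ?y i - q ^ ?z i) :: rat poly))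
      = (\<Prod>i=1..l. qint q (monom 1 (q ^ y i - q ^ z i))) * qint q (monom 1 (q ^ a - q ^ b))"
    by simp
  then have "at_tvar (monom 1 x * (\<Prod>i=1..Suc l. qint q (monom 1 (q ^ ?y i - q ^ ?z i))))
      = at_tvar (monom 1 x * (\<Prod>i=1..l. qint q (monom 1 (q ^ y i - q ^ z i))))
        * qint q (tvar ^ (q ^ a - q ^ b))"
    by (simp only: at_tvar_mult at_tvar_qint at_tvar_monom mult.assoc)
  then have "specializes q (F * twisted_qint a b)
      (at_tvar (monom 1 x * (\<Prod>i=1..Suc l. qint q (monom 1 (q ^ ?y i - q ^ ?z i)))))"
    using ratsubst_mult[OF *(2)[unfolded specializes_def]
        specializes_twisted_qint[OF assms twisted.hyps(2), unfolded specializes_def]]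
    by (simp add: specializes_def)
  moreover have "\<forall>i\<in>{1..Suc l}. ?z i < ?y i"
    using *(1) twisted.hyps(2) by auto
  ultimately show ?case by blast
qed

lemma nonneg_coeff_mult:
  fixes P R :: "rat poly"
  assumes "\<forall>i. 0 \<le> coeff P i" "\<forall>i. 0 \<le> coeff R i"
  shows "\<forall>i. 0 \<le> coeff (P * R) i"
  using assms by (auto simp: coeff_mult intro!: sum_nonneg)

lemma nonneg_coeff_prod:
  fixes f :: "'i \<Rightarrow> rat poly"
  assumes "\<And>i. i \<in> S \<Longrightarrow> \<forall>j. 0 \<le> coeff (f i) j"
  shows "\<forall>j. 0 \<le> coeff (prod f S) j"
  using assms
proof (induction S rule: infinite_finite_induct)
  case (insert i S)
  then show ?case by (simp del: mult_pCons_left add: nonneg_coeff_mult)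
qed (simp_all add: coeff_1)

lemma nonneg_coeff_qint_monom: "\<forall>j. 0 \<le> coeff (qint q (monom (1 :: rat) d)) j"
  by (simp add: qint_def coeff_sum monom_power sum_nonneg)

section \<open>Grassmannian permutations\<close>

lemma permutesI_inj_on:
  assumes "finite S" "inj_on p S" "p ` S \<subseteq> S" "\<And>x. x \<notin> S \<Longrightarrow> p x = x"
  shows "p permutes S"
  using assms endo_inj_surj[OF assms(1,3,2)] by (intro bij_imp_permutes) (auto simp: bij_betw_def)

text \<open>At the first argument where \<open>f\<close> and \<open>g\<close> differ, the smaller of the two values would be missed by
  the other function: its earlier values are those of the first function, its later ones are too
  large.\<close>

lemma strict_mono_on_same_image:
  fixes f g :: "nat \<Rightarrow> nat"
  assumes f: "strict_mono_on I f" and g: "strict_mono_on I g" and im: "f ` I = g ` I" and "i \<in> I"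
  shows "f i = g i"
  using \<open>i \<in> I\<close>
proof (induction i rule: less_induct)
  case (less i)
  have no_gap: "\<not> f' i < g' i"
    if f': "strict_mono_on I f'" and g': "strict_mono_on I g'" and im': "f' ` I = g' ` I"
      and eq: "\<And>j. j < i \<Longrightarrow> j \<in> I \<Longrightarrow> f' j = g' j"
    for f' g' :: "nat \<Rightarrow> nat"
  proof
    assume lt: "f' i < g' i"
    obtain j where j: "j \<in> I" "f' i = g' j" using im' less.prems by (metis imageE imageI)
    show False
    proof (cases "j < i")
      case True
      then have "f' j = f' i" using eq j by simp
      then show False using strict_mono_onD[OF f' j(1) less.prems True] by simp
    next
      case False
      then have "g' i \<le> g' j"
        using strict_mono_onD[OF g' less.prems j(1)] by (cases "i = j") auto
      then show False using j lt by simp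
    qed
  qed
  show ?case
    using no_gap[OF f g im] no_gap[OF g f im[symmetric]] less.IH by (metis linorder_neqE_nat)
qed

definition grassmannian :: "nat \<Rightarrow> nat \<Rightarrow> (nat \<Rightarrow> nat) \<Rightarrow> bool" where
  "grassmannian n k u \<longleftrightarrow>
     u permutes {1..n} \<and> strict_mono_on {1..k} u \<and> strict_mono_on {k+1..n} u"

text \<open>The image of the first block determines the image of the second, and on each block a strictly
  increasing function is determined by its image.\<close>

lemma grassmannian_eqI:
  assumes u: "grassmannian n k u" and v: "grassmannian n k v" and im: "u ` {1..k} = v ` {1..k}"
    and "k \<le> n"
  shows "u = v"
proof
  fix i
  have split: "{k+1..n} = {1..n} - {1..k}" using \<open>k \<le> n\<close> by auto
  have p: "u permutes {1..n}" "v permutes {1..n}" using u v by (auto simp: grassmannian_def)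
  have "u ` {k+1..n} = u ` {1..n} - u ` {1..k}" "v ` {k+1..n} = v ` {1..n} - v ` {1..k}"
    unfolding split by (intro image_set_diff permutes_inj[OF p(1)] permutes_inj[OF p(2)])+
  then have im': "u ` {k+1..n} = v ` {k+1..n}"
    using im by (simp only: permutes_image[OF p(1)] permutes_image[OF p(2)])
  consider "i \<in> {1..k}" | "i \<in> {k+1..n}" | "i \<notin> {1..n}" using split by blast
  then show "u i = v i"
  proof cases
    case 1
    then show ?thesis using u v im
      by (intro strict_mono_on_same_image[of "{1..k}"]) (auto simp: grassmannian_def)
  next
    case 2
    then show ?thesis using u v im'
      by (intro strict_mono_on_same_image[of "{k+1..n}"]) (auto simp: grassmannian_def)
  next
    case 3
    then show ?thesis using p by (simp add: permutes_not_in)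
  qed
qed

lemma strict_mono_on_enumeration:
  fixes S :: "nat set"
  assumes "finite S"
  obtains f where "bij_betw f {d+1..d+card S} S" "strict_mono_on {d+1..d+card S} f"
proof -
  obtain h where h: "bij_betw h {..<card S} S" "strict_mono_on {..<card S} h"
    using ex_bij_betw_strict_mono_card[OF assms] by blast
  have "bij_betw (\<lambda>i. i - Suc d) {d+1..d+card S} {..<card S}"
    by (rule bij_betw_byWitness[where f' = "\<lambda>i. i + Suc d"]) auto
  then have "bij_betw (\<lambda>i. h (i - Suc d)) {d+1..d+card S} S"
    using bij_betw_trans[OF _ h(1)] by (fastforce simp: comp_def)
  moreover have "strict_mono_on {d+1..d+card S} (\<lambda>i. h (i - Suc d))"
    by (intro strict_mono_onI strict_mono_onD[OF h(2)]) auto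
  ultimately show ?thesis using that by blast
qed

lemma grassmannian_exists:
  assumes "S \<subseteq> {1..n}" "card S = k"
  obtains u where "grassmannian n k u" "u ` {1..k} = S"
proof -
  have fin: "finite S" using assms finite_subset by blast
  have "k \<le> n" using assms card_mono[of "{1..n}" S] by simp
  have card: "card ({1..n} - S) = n - k" using assms by (simp add: card_Diff_subset fin)
  obtain f where f: "bij_betw f {1..k} S" "strict_mono_on {1..k} f"
    using strict_mono_on_enumeration[OF fin, of 0] assms by auto
  obtain g where g: "bij_betw g {k+1..n} ({1..n} - S)" "strict_mono_on {k+1..n} g"
    using strict_mono_on_enumeration[of "{1..n} - S" k] card \<open>k \<le> n\<close> by auto
  define u where "u i = (if i \<in> {1..k} then f i else if i \<in> {k+1..n} then g i else i)" for i
  have uf: "u i = f i" if "i \<in> {1..k}" for i using that by (simp add: u_def)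
  have ug: "u i = g i" if "i \<in> {k+1..n}" for i using that by (simp add: u_def)
  have bij: "bij_betw u {1..k} S" "bij_betw u {k+1..n} ({1..n} - S)"
    using f(1) g(1) bij_betw_cong[of "{1..k}" u f S, OF uf]
      bij_betw_cong[of "{k+1..n}" u g "{1..n} - S", OF ug] by blast+
  have "bij_betw u ({1..k} \<union> {k+1..n}) (S \<union> ({1..n} - S))"
    by (rule bij_betw_combine[OF bij]) auto
  moreover have "{1..k} \<union> {k+1..n} = {1..n}" "S \<union> ({1..n} - S) = {1..n}"
    using \<open>k \<le> n\<close> assms by auto
  ultimately have "u permutes {1..n}"
    using \<open>k \<le> n\<close> by (intro bij_imp_permutes) (auto simp: u_def)
  moreover have "strict_mono_on {1..k} u" "strict_mono_on {k+1..n} u"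
    using f(2) g(2) uf ug by (simp_all add: strict_mono_on_def)
  ultimately show ?thesis
    using that bij(1) by (auto simp: grassmannian_def bij_betw_def)
qed

lemma strict_mono_on_increment:
  fixes f :: "nat \<Rightarrow> nat"
  assumes "strict_mono_on {1..k} f" "1 \<le> i" "i \<le> j" "j \<le> k"
  shows "f i + (j - i) \<le> f j"
  using assms(3,4)
proof (induction j rule: dec_induct)
  case base
  then show ?case by simp
next
  case (step j)
  then have "f j < f (Suc j)"
    using assms(1,2) by (intro strict_mono_onD[OF assms(1)]) auto
  then show ?case using step by auto
qed

lemma u_perm_eqI:
  assumes "grassmannian n k u" "k \<le> n" "\<And>i. i \<in> {1..k} \<Longrightarrow> u i = lam (k + 1 - i) + i"
  shows "u_perm n k lam = u"
  unfolding u_perm_def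
proof (rule the_equality)
  fix v
  assume v: "v permutes {1..n} \<and> strict_mono_on {1..k} v \<and> strict_mono_on {k + 1..n} v \<and>
     (\<forall>i\<in>{1..k}. v i = lam (k + 1 - i) + i)"
  then have "v ` {1..k} = u ` {1..k}"
    using assms(3) by (intro image_cong) auto
  then show "v = u"
    using v assms by (intro grassmannian_eqI[of n k]) (auto simp: grassmannian_def)
qed (use assms in \<open>auto simp: grassmannian_def\<close>)

text \<open>The description defining \<open>u_perm\<close> has a solution: the prescribed values
  \<open>\<lambda>\<^bsub>k+1-i\<^esub> + i\<close> increase strictly in \<open>i\<close> since \<open>\<lambda>\<close> decreases weakly, so they form a
  \<open>k\<close>-element subset of \<open>{1..n}\<close>, whose Grassmannian permutation attains them in this order.\<close>

lemma u_perm_grassmannian: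
  assumes "partition_in_rect k (n - k) lam" "k \<le> n"
  shows "grassmannian n k (u_perm n k lam)"
    and "i \<in> {1..k} \<Longrightarrow> u_perm n k lam i = lam (k + 1 - i) + i"
proof -
  let ?f = "\<lambda>i. lam (k + 1 - i) + i"
  have f: "strict_mono_on {1..k} ?f"
  proof (rule strict_mono_onI)
    fix i j assume "i \<in> {1..k}" "j \<in> {1..k}" "i < j"
    then have "k + 1 - i \<in> {1..k}" "k + 1 - j \<in> {1..k}" "k + 1 - j \<le> k + 1 - i" by auto
    then have "lam (k + 1 - i) \<le> lam (k + 1 - j)"
      using assms(1) unfolding partition_in_rect_def by blast
    then show "?f i < ?f j" using \<open>i < j\<close> by simp
  qed
  have "?f i \<le> n" if "i \<in> {1..k}" for i
  proof -
    have "lam (k + 1 - i) \<le> n - k" using assms(1) that by (auto simp: partition_in_rect_def)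
    then show ?thesis using that assms(2) by auto
  qed
  then have "?f ` {1..k} \<subseteq> {1..n}" by auto
  moreover have "card (?f ` {1..k}) = k"
    using card_image[OF strict_mono_on_imp_inj_on[OF f]] by simp
  ultimately obtain u where u: "grassmannian n k u" "u ` {1..k} = ?f ` {1..k}"
    using grassmannian_exists by blast
  have val: "u i = ?f i" if "i \<in> {1..k}" for i
    using strict_mono_on_same_image[OF _ f u(2) that] u(1) by (auto simp: grassmannian_def)
  then have "u_perm n k lam = u"
    using u_perm_eqI[OF u(1) assms(2)] by blast
  then show "grassmannian n k (u_perm n k lam)"
    and "i \<in> {1..k} \<Longrightarrow> u_perm n k lam i = lam (k + 1 - i) + i"
    using u(1) val by auto
qed

text \<open>Conversely, \<open>u i - i\<close> increases weakly because \<open>u\<close> has steps of size at least one, starts at a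
  value \<open>\<ge> 0\<close> since \<open>u 1 \<ge> 1\<close>, and ends at a value \<open>\<le> n - k\<close> since \<open>u k \<le> n\<close>; read backwards it is a
  partition in the rectangle.\<close>

lemma grassmannian_partition:
  assumes "grassmannian n k u" "k \<le> n"
  defines "lam \<equiv> \<lambda>j. if j \<in> {1..k} then u (k + 1 - j) - (k + 1 - j) else 0"
  shows "partition_in_rect k (n - k) lam" "u_perm n k lam = u"
proof -
  have mono: "strict_mono_on {1..k} u" and perm: "u permutes {1..n}"
    using assms(1) by (auto simp: grassmannian_def)
  have range: "1 \<le> u i \<and> u i \<le> n" if "i \<in> {1..k}" for i
    using permutes_in_image[OF perm, of i] that assms(2) by auto
  have lower: "i \<le> u i" if "i \<in> {1..k}" for i
    using strict_mono_on_increment[OF mono, of 1 i] range[of 1] that by auto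
  have incr: "u i + (j - i) \<le> u j" if "1 \<le> i" "i \<le> j" "j \<le> k" for i j
    using strict_mono_on_increment[OF mono that] .
  show "partition_in_rect k (n - k) lam"
    unfolding partition_in_rect_def
  proof (intro conjI ballI allI impI)
    show "lam i = 0" if "i \<notin> {1..k}" for i using that by (auto simp: lam_def)
    show "lam i \<le> n - k" if "i \<in> {1..k}" for i
    proof -
      have "u (k + 1 - i) + (k - (k + 1 - i)) \<le> u k" using that by (intro incr) auto
      then show ?thesis using that range[of k] by (auto simp: lam_def)
    qed
    show "lam j \<le> lam i" if "i \<in> {1..k}" "j \<in> {1..k}" "i \<le> j" for i j
    proof -
      have "u (k + 1 - j) + (k + 1 - i - (k + 1 - j)) \<le> u (k + 1 - i)"
        using that by (intro incr) auto
      then show ?thesis using that by (auto simp: lam_def)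
    qed
  qed
  show "u_perm n k lam = u"
    using lower by (intro u_perm_eqI[OF assms(1,2)]) (auto simp: lam_def)
qed

section \<open>The factorization of a permutation\<close>

text \<open>The factors \<open>a\<close> and \<open>b\<close> preserve \<open>{1..k}\<close>, so the Grassmannian factor is recovered from the
  set \<open>w ` {1..k}\<close>; cancelling it leaves \<open>a \<circ> b\<close>, whose two factors have disjoint supports.\<close>

lemma factors_unique:
  assumes "k < n" "factors n k w (lam, a, b)" "factors n k w (lam', a', b')"
  shows "(lam, a, b) = (lam', a', b')"
proof -
  let ?u = "u_perm n k lam" and ?u' = "u_perm n k lam'"
  have p: "partition_in_rect k (n - k) lam" "a permutes {1..k}" "b permutes {k+2..n}"
    and w: "w = ?u \<circ> a \<circ> b"
    and p': "partition_in_rect k (n - k) lam'" "a' permutes {1..k}" "b' permutes {k+2..n}"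
    and w': "w = ?u' \<circ> a' \<circ> b'"
    using assms(2,3) by (auto simp: factors_def)
  note u = u_perm_grassmannian[OF p(1) less_imp_le[OF assms(1)]]
  note u' = u_perm_grassmannian[OF p'(1) less_imp_le[OF assms(1)]]
  have fix_low: "c i = i" if "c permutes {k+2..n}" "i \<in> {1..k}" for c i
    using that by (auto simp: permutes_not_in)
  have im: "(v \<circ> c \<circ> d) ` {1..k} = v ` {1..k}"
    if "c permutes {1..k}" "d permutes {k+2..n}" for v c d :: "nat \<Rightarrow> nat"
  proof -
    have "(v \<circ> c \<circ> d) ` {1..k} = v ` c ` d ` {1..k}" by (simp add: image_comp)
    also have "d ` {1..k} = {1..k}" using fix_low[OF that(2)] by simp
    finally show ?thesis by (simp only: permutes_image[OF that(1)])
  qed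
  have "?u ` {1..k} = ?u' ` {1..k}"
    using im[OF p(2,3), of ?u] im[OF p'(2,3), of ?u'] by (simp only: w[symmetric] w'[symmetric])
  then have uu: "?u = ?u'"
    using grassmannian_eqI[OF u(1) u'(1)] assms(1) by simp
  have "lam j = lam' j" for j
  proof (cases "j \<in> {1..k}")
    case True
    then have j: "k + 1 - j \<in> {1..k}" "k + 1 - (k + 1 - j) = j" by auto
    show ?thesis using u(2)[OF j(1)] u'(2)[OF j(1)] by (simp only: uu j(2))
  next
    case False
    then show ?thesis using p(1) p'(1) by (simp add: partition_in_rect_def)
  qed
  then have lam: "lam = lam'" by blast
  have "inj ?u" using u(1) permutes_inj by (auto simp: grassmannian_def)
  then have ab: "a (b i) = a' (b' i)" for i
    using w w' uu by (metis comp_apply injD)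
  have "a i = a' i" for i
    using ab[of i] fix_low[OF p(3), of i] fix_low[OF p'(3), of i] p(2) p'(2)
    by (cases "i \<in> {1..k}") (auto simp: permutes_not_in)
  moreover have "b i = b' i" for i
  proof (cases "i \<in> {k+2..n}")
    case True
    then have "b i \<in> {k+2..n}" "b' i \<in> {k+2..n}"
      using p(3) p'(3) permutes_in_image by metis+
    then have "b i \<notin> {1..k}" "b' i \<notin> {1..k}" by auto
    then show ?thesis
      using ab[of i] p(2) p'(2) by (metis permutes_not_in)
  next
    case False
    then show ?thesis using p(3) p'(3) by (simp add: permutes_not_in)
  qed
  ultimately show ?thesis using lam by blast
qed

text \<open>For \<open>u\<close> Grassmannian with \<open>u ` {1..k} = w ` {1..k}\<close>, the value \<open>1\<close> lies outside this image, so it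
  is the first value on the second block: \<open>u (k + 1) = 1\<close>.  Hence \<open>inv u \<circ> w\<close> fixes
  \<open>k + 1\<close> and preserves \<open>{1..k}\<close> and \<open>{k+2..n}\<close>, and its restrictions are \<open>a\<close> and \<open>b\<close>.\<close>

lemma factors_exist:
  assumes w: "w permutes {1..n}" and "k < n" and wk: "w (k + 1) = 1"
  obtains lam a b where "factors n k w (lam, a, b)" "u_perm n k lam (k + 1) = 1"
proof -
  have wS: "w ` {1..k} \<subseteq> {1..n}"
    using permutes_image[OF w] \<open>k < n\<close> by auto
  have "card (w ` {1..k}) = k"
    using card_image[OF inj_on_subset[OF permutes_inj[OF w]]] by simp
  then obtain u where u: "grassmannian n k u" "u ` {1..k} = w ` {1..k}"
    using grassmannian_exists[OF wS] by blast
  have up: "u permutes {1..n}" and um: "strict_mono_on {k+1..n} u"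
    using u(1) by (auto simp: grassmannian_def)
  have u1: "u (k + 1) = 1"
  proof -
    have "1 \<in> u ` {1..n}" using permutes_image[OF up] \<open>k < n\<close> by simp
    then obtain j where j: "j \<in> {1..n}" "u j = 1" by auto
    have "j \<notin> {1..k}"
    proof
      assume "j \<in> {1..k}"
      then obtain i where "i \<in> {1..k}" "w i = 1" using u(2) j(2) by (metis imageE imageI)
      then show False using wk injD[OF permutes_inj[OF w], of i "k + 1"] by auto
    qed
    then have "j = k + 1 \<or> u (k + 1) < u j"
      using j \<open>k < n\<close> strict_mono_onD[OF um, of "k + 1" j] by (cases "j = k + 1") auto
    moreover have "u (k + 1) \<in> {1..n}" using permutes_in_image[OF up] \<open>k < n\<close> by simp
    ultimately show ?thesis using j(2) by auto
  qed
  define v where "v = inv u \<circ> w"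
  have vp: "v permutes {1..n}" unfolding v_def by (intro permutes_compose permutes_inv up w)
  have v1: "v (k + 1) = k + 1"
    using permutes_inverses(2)[OF up, of "k + 1"] by (simp only: v_def comp_apply wk u1)
  have "v ` {1..k} = inv u ` u ` {1..k}" by (simp only: v_def image_comp[symmetric] u(2))
  then have vlow: "v ` {1..k} = {1..k}"
    using permutes_inv_o(2)[OF up] by (simp add: image_comp)
  have "{k+2..n} = {1..n} - insert (k + 1) {1..k}" using \<open>k < n\<close> by auto
  then have vhigh: "v ` {k+2..n} = {k+2..n}"
    by (simp only: image_set_diff[OF permutes_inj[OF vp]] permutes_image[OF vp] image_insert v1 vlow)
  define a where "a i = (if i \<in> {1..k} then v i else i)" for i
  define b where "b i = (if i \<in> {k+2..n} then v i else i)" for i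
  have restrict: "(\<lambda>i. if i \<in> A then v i else i) permutes A" if "v ` A = A" for A
  proof (rule bij_imp_permutes)
    have "bij_betw v A A"
      using that inj_on_subset[OF permutes_inj[OF vp]] by (simp add: bij_betw_def)
    then show "bij_betw (\<lambda>i. if i \<in> A then v i else i) A A"
      by (rule bij_betw_cong[THEN iffD1, rotated]) simp
  qed simp
  have "a permutes {1..k}" "b permutes {k+2..n}"
    unfolding a_def b_def using restrict vlow vhigh by blast+
  moreover have "w = u \<circ> a \<circ> b"
  proof
    fix i
    have "a (b i) = v i"
    proof -
      consider "i \<in> {1..k}" | "i = k + 1" | "i \<in> {k+2..n}" | "i \<notin> {1..n}" by fastforce
      then show ?thesis
      proof cases
        case 3
        then have "v i \<in> {k+2..n}" using vhigh by blast
        then show ?thesis using 3 by (auto simp: a_def b_def)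
      qed (use v1 permutes_not_in[OF vp] \<open>k < n\<close> in \<open>auto simp: a_def b_def\<close>)
    qed
    then show "w i = (u \<circ> a \<circ> b) i"
      by (simp add: v_def permutes_inverses(1)[OF up])
  qed
  moreover obtain lam where lam: "partition_in_rect k (n - k) lam" "u_perm n k lam = u"
    using grassmannian_partition[OF u(1) less_imp_le[OF \<open>k < n\<close>]] by blast
  ultimately have "factors n k w (lam, a, b)" by (simp add: factors_def)
  then show ?thesis using that u1 lam(2) by blast
qed

section \<open>Inversions of the factorization\<close>

definition inversions :: "nat \<Rightarrow> (nat \<Rightarrow> nat) \<Rightarrow> (nat \<times> nat) set" where
  "inversions n w = {(i, j). i \<in> {1..n} \<and> j \<in> {1..n} \<and> i < j \<and> w j < w i}"

lemma finite_inversions: "finite (inversions n w)"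
  by (rule finite_subset[of _ "{1..n} \<times> {1..n}"]) (auto simp: inversions_def)

lemma inv_count_eq_card: "inv_count n w = card (inversions n w)"
  by (simp only: inv_count_def inversions_def)

text \<open>For \<open>u\<close> with \<open>u (k + 1) = 1\<close> this erases position \<open>k + 1\<close> and value \<open>1\<close> and relabels.\<close>

definition delete_value_one :: "nat \<Rightarrow> (nat \<Rightarrow> nat) \<Rightarrow> nat \<Rightarrow> nat" where
  "delete_value_one k u i = u (if i \<le> k then i else i + 1) - 1"

text \<open>Removing the first column of \<open>\<lambda>\<close> lowers the first \<open>k\<close> values by one, exactly as erasing the value
  \<open>1\<close> does.  This gives the smaller Grassmannian permutation of the recursion in terms of the
  larger one, so that their inversions can be compared without counting the boxes of \<open>\<lambda>\<close>.\<close>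

lemma u_perm_delete_value_one:
  assumes lam: "partition_in_rect k (n - k) lam" and "k < n" and one: "u_perm n k lam (k + 1) = 1"
  shows "grassmannian (n - 1) k (delete_value_one k (u_perm n k lam))"
    and "u_perm (n - 1) k (\<lambda>i. lam i - 1) = delete_value_one k (u_perm n k lam)"
proof -
  let ?u = "u_perm n k lam" and ?s = "\<lambda>i. if i \<le> k then i else i + 1" and ?d = "delete_value_one k (u_perm n k lam)"
  note u = u_perm_grassmannian[OF lam less_imp_le[OF \<open>k < n\<close>]]
  have up: "?u permutes {1..n}" and um: "strict_mono_on {1..k} ?u" "strict_mono_on {k+1..n} ?u"
    using u(1) by (auto simp: grassmannian_def)
  have ge2: "2 \<le> ?u i" "?u i \<le> n" if "i \<in> {1..n}" "i \<noteq> k + 1" for i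
  proof -
    have "?u i \<in> {1..n}" using permutes_in_image[OF up] that(1) by simp
    moreover have "?u i \<noteq> 1" using one that(2) injD[OF permutes_inj[OF up], of i "k + 1"] by auto
    ultimately show "2 \<le> ?u i" "?u i \<le> n" by auto
  qed
  have d: "?d i + 1 = ?u (?s i)" "?d i \<in> {1..n-1}" if "i \<in> {1..n-1}" for i
  proof -
    have "?s i \<in> {1..n}" "?s i \<noteq> k + 1" using that by auto
    note ge2[OF this]
    moreover have "?d i = ?u (?s i) - 1" using that by (simp add: delete_value_one_def)
    ultimately show "?d i + 1 = ?u (?s i)" "?d i \<in> {1..n-1}"
      unfolding atLeastAtMost_iff by linarith+
  qed
  have "inj_on ?d {1..n-1}"
  proof (rule inj_onI)
    fix i j assume ij: "i \<in> {1..n-1}" "j \<in> {1..n-1}" "?d i = ?d j"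
    have "?u (?s i) = ?u (?s j)"
      by (simp only: d(1)[OF ij(1), symmetric] d(1)[OF ij(2), symmetric] ij(3))
    from injD[OF permutes_inj[OF up] this] show "i = j" by (auto split: if_splits)
  qed
  moreover have "?d i = i" if "i \<notin> {1..n-1}" for i
    using that \<open>k < n\<close> by (auto simp: delete_value_one_def permutes_not_in[OF up])
  ultimately have "?d permutes {1..n-1}"
    using d(2) by (intro permutesI_inj_on) auto
  moreover have "strict_mono_on {1..k} ?d"
  proof (rule strict_mono_onI)
    fix i j assume ij: "i \<in> {1..k}" "j \<in> {1..k}" "i < j"
    then have "?d i + 1 < ?d j + 1"
      using d(1)[of i] d(1)[of j] strict_mono_onD[OF um(1) ij] \<open>k < n\<close> by auto
    then show "?d i < ?d j" by simp
  qed
  moreover have "strict_mono_on {k+1..n-1} ?d"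
  proof (rule strict_mono_onI)
    fix i j assume ij: "i \<in> {k+1..n-1}" "j \<in> {k+1..n-1}" "i < j"
    then have "?d i + 1 < ?d j + 1"
      using d(1)[of i] d(1)[of j] strict_mono_onD[OF um(2), of "i + 1" "j + 1"] by auto
    then show "?d i < ?d j" by simp
  qed
  ultimately show g: "grassmannian (n - 1) k ?d" by (simp add: grassmannian_def)
  show "u_perm (n - 1) k (\<lambda>i. lam i - 1) = ?d"
  proof (rule u_perm_eqI[OF g])
    fix i assume i: "i \<in> {1..k}"
    \<comment> \<open>The truncated subtraction \<open>lam (k + 1 - i) - 1\<close> is harmless because all \<open>k\<close> parts are positive;
      the smallest one is \<open>u 1 - 1\<close>.\<close>
    have "2 \<le> lam k + 1" using u(2)[of 1] ge2[of 1] i \<open>k < n\<close> by auto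
    moreover have "lam k \<le> lam (k + 1 - i)"
    proof -
      have "k + 1 - i \<in> {1..k}" "k \<in> {1..k}" "k + 1 - i \<le> k" using i by auto
      then show ?thesis using lam unfolding partition_in_rect_def by blast
    qed
    ultimately show "?d i = lam (k + 1 - i) - 1 + i"
      using u(2)[OF i] i by (auto simp: delete_value_one_def)
  qed (use \<open>k < n\<close> in simp)
qed

text \<open>The inversions of \<open>u \<circ> a \<circ> b\<close> are sorted by the position of their two ends relative to
  \<open>k + 1\<close>, where the value is \<open>1\<close>.  Each of the \<open>k\<close> earlier positions is inverted with \<open>k + 1\<close>, and no
  later one is.  Within the first block, and within the last, \<open>u\<close> is increasing, so the inversions
  are those of \<open>a\<close> and of \<open>b\<close>.  The pairs across are carried by \<open>a\<close> and \<open>b\<close> to the inversions of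
  \<open>u\<close> avoiding position \<open>k + 1\<close>, which are the inversions of \<open>delete_value_one k u\<close>.\<close>

lemma inv_count_decomposition:
  assumes u: "grassmannian n k u" and u1: "u (k + 1) = 1" and "k < n"
    and ud: "grassmannian (n - 1) k (delete_value_one k u)"
    and a: "a permutes {1..k}" and b: "b permutes {k+2..n}"
  shows "inv_count n (u \<circ> a \<circ> b) =
    k + inv_count (n - 1) (delete_value_one k u) + inv_count k a + inv_count (n - k - 1) (unshift (k + 1) b)"
proof -
  let ?w = "u \<circ> a \<circ> b" and ?d = "k + 1"
  have up: "u permutes {1..n}" and um: "strict_mono_on {1..k} u" "strict_mono_on {k+1..n} u"
    using u by (auto simp: grassmannian_def)
  have dm: "strict_mono_on {1..k} (delete_value_one k u)" "strict_mono_on {k+1..n-1} (delete_value_one k u)"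
    using ud by (auto simp: grassmannian_def)
  have wlow: "?w i = u (a i)" "a i \<in> {1..k}" if "i \<in> {1..k}" for i
    using that permutes_not_in[OF b, of i] permutes_in_image[OF a, of i] by auto
  have wmid: "?w (k + 1) = 1"
    using permutes_not_in[OF b, of "k+1"] permutes_not_in[OF a, of "k+1"] u1 by auto
  have whigh: "?w i = u (b i)" "b i \<in> {k+2..n}" if "i \<in> {k+2..n}" for i
  proof -
    show "b i \<in> {k+2..n}" using permutes_in_image[OF b, of i] that by auto
    then show "?w i = u (b i)" using permutes_not_in[OF a, of "b i"] by auto
  qed
  have ge2: "2 \<le> u i" if "i \<in> {1..n}" "i \<noteq> k + 1" for i
  proof -
    have "u i \<in> {1..n}" using permutes_in_image[OF up] that(1) by simp
    moreover have "u i \<noteq> 1" using u1 that(2) injD[OF permutes_inj[OF up], of i "k + 1"] by auto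
    ultimately show ?thesis by auto
  qed
  have less_low: "u i < u j \<longleftrightarrow> i < j" if "i \<in> {1..k}" "j \<in> {1..k}" for i j
    using strict_mono_on_less[OF um(1)] that by simp
  have less_high: "u i < u j \<longleftrightarrow> i < j" if "i \<in> {k+1..n}" "j \<in> {k+1..n}" for i j
    using strict_mono_on_less[OF um(2)] that by simp
  \<comment> \<open>\<open>M\<close>, \<open>X\<close> and \<open>H\<close>: pairs ending in the middle position, pairs across it, pairs beyond it.\<close>
  define M where "M = {1..k} \<times> {k + 1}"
  define X where "X = {(i, j). i \<in> {1..k} \<and> j \<in> {k+2..n} \<and> ?w j < ?w i}"
  define H where "H = {(i, j). i \<in> {k+2..n} \<and> j \<in> {k+2..n} \<and> i < j \<and> b j < b i}"
  have low: "inversions n ?w \<inter> {1..k} \<times> {1..k} = inversions k a"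
    using wlow less_low \<open>k < n\<close> by (auto simp: inversions_def)
  have mid: "inversions n ?w \<inter> {1..k} \<times> {k+1} = M"
  proof -
    have "?w (k + 1) < ?w i" if "i \<in> {1..k}" for i
      using ge2[of "a i"] wlow[OF that] wmid \<open>k < n\<close> by simp
    then show ?thesis using \<open>k < n\<close> by (auto simp: inversions_def M_def)
  qed
  have cross: "inversions n ?w \<inter> {1..k} \<times> {k+2..n} = X"
    by (auto simp: inversions_def X_def)
  have high: "inversions n ?w \<inter> {k+2..n} \<times> {k+2..n} = H"
  proof -
    have "?w j < ?w i \<longleftrightarrow> b j < b i" if "i \<in> {k+2..n}" "j \<in> {k+2..n}" for i j
      using whigh[OF that(1)] whigh[OF that(2)] less_high[of "b j" "b i"] by simp
    then show ?thesis unfolding inversions_def H_def by (auto simp del: comp_apply)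
  qed
  have "inversions n ?w = inversions k a \<union> M \<union> X \<union> H"
  proof -
    have "p \<in> {1..k} \<times> {1..k} \<union> {1..k} \<times> {k+1} \<union> {1..k} \<times> {k+2..n} \<union> {k+2..n} \<times> {k+2..n}"
      if "p \<in> inversions n ?w" for p
    proof -
      obtain i j where p: "p = (i, j)" "i \<in> {1..n}" "j \<in> {1..n}" "i < j" "?w j < ?w i"
        using \<open>p \<in> inversions n ?w\<close> by (auto simp: inversions_def)
      have "i \<noteq> k + 1"
      proof
        assume "i = k + 1"
        then have "?w j < 1" using p(5) wmid by simp
        moreover have "?w j \<noteq> 0"
          using whigh[of j] ge2[of "b j"] p \<open>i = k + 1\<close> by auto
        ultimately show False by simp
      qed
      then show ?thesis using p by auto
    qed
    then show ?thesis using low mid cross high by blast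
  qed
  moreover have "inversions k a \<inter> M = {}" "(inversions k a \<union> M) \<inter> X = {}"
    "(inversions k a \<union> M \<union> X) \<inter> H = {}"
    by (auto simp: inversions_def M_def X_def H_def)
  moreover have fin: "finite M" "finite X" "finite H"
    using finite_inversions[of n ?w] mid cross high by (metis finite_Int)+
  ultimately have "card (inversions n ?w) = card (inversions k a) + card M + card X + card H"
    using finite_inversions[of k a] by (simp add: card_Un_disjoint)
  moreover have "card M = k" by (simp add: M_def)
  moreover have "card X = card (inversions (n - 1) (delete_value_one k u))"
  proof -
    let ?g = "\<lambda>(i, j). (a i, b j - 1)"
    have "inj_on ?g X"
    proof (rule inj_onI, clarify)
      fix i j i' j' assume "(i, j) \<in> X" "(i', j') \<in> X" and eq: "a i = a i'" "b j - 1 = b j' - 1"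
      then have "j \<in> {k+2..n}" "j' \<in> {k+2..n}" by (auto simp: X_def)
      then have "b j = b j'" using whigh(2)[of j] whigh(2)[of j'] eq by auto
      then show "i = i' \<and> j = j'"
        using eq(1) injD[OF permutes_inj[OF a]] injD[OF permutes_inj[OF b]] by blast
    qed
    moreover have "?g ` X = inversions (n - 1) (delete_value_one k u)"
    proof (intro subset_antisym subsetI)
      fix p assume "p \<in> ?g ` X"
      then obtain i j where ij: "i \<in> {1..k}" "j \<in> {k+2..n}" "?w j < ?w i" "p = (a i, b j - 1)"
        by (auto simp: X_def)
      then show "p \<in> inversions (n - 1) (delete_value_one k u)"
        using wlow[OF ij(1)] whigh[OF ij(2)] ge2[of "b j"] \<open>k < n\<close>
        by (auto simp: inversions_def delete_value_one_def)
    next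
      fix p assume "p \<in> inversions (n - 1) (delete_value_one k u)"
      then obtain i j where ij: "p = (i, j)" "i \<in> {1..n-1}" "j \<in> {1..n-1}" "i < j"
        "delete_value_one k u j < delete_value_one k u i"
        by (auto simp: inversions_def)
      have i: "i \<in> {1..k}"
        using ij strict_mono_onD[OF dm(2), of i j] by (cases "i \<le> k") auto
      have j: "j + 1 \<in> {k+2..n}"
        using ij strict_mono_onD[OF dm(1), of i j] i by (cases "j \<le> k") auto
      obtain i' where i': "i' \<in> {1..k}" "a i' = i" using i permutes_image[OF a] by (metis imageE)
      obtain j' where j': "j' \<in> {k+2..n}" "b j' = j + 1" using j permutes_image[OF b] by (metis imageE)
      have "u (j + 1) < u i" using ij(5) i j ge2[of i] by (auto simp: delete_value_one_def split: if_splits)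
      then have "(i', j') \<in> X" using i' j' wlow[of i'] whigh[of j'] by (simp add: X_def)
      then show "p \<in> ?g ` X" using i' j' ij(1) by force
    qed
    ultimately show ?thesis using card_image by metis
  qed
  moreover have "card H = card (inversions (n - k - 1) (unshift (k + 1) b))"
  proof -
    let ?g = "\<lambda>(i, j). (i + ?d, j + ?d)"
    let ?I = "inversions (n - k - 1) (unshift (k + 1) b)"
    have un: "unshift ?d b i + ?d = b (i + ?d)" if "i \<in> {1..n-k-1}" for i
    proof -
      have "i + ?d \<in> {k+2..n}" using that by auto
      from whigh(2)[OF this] show ?thesis by (simp add: unshift_def)
    qed
    have "inj_on ?g ?I" by (auto simp: inj_on_def)
    moreover have "?g ` ?I = H"
    proof (intro subset_antisym subsetI)
      fix p assume "p \<in> ?g ` ?I"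
      then obtain i j where ij: "i \<in> {1..n-k-1}" "j \<in> {1..n-k-1}" "i < j"
        "unshift ?d b j < unshift ?d b i" "p = (i + ?d, j + ?d)"
        by (auto simp: inversions_def)
      then have "b (j + ?d) < b (i + ?d)" using un[of i] un[of j] by simp
      then show "p \<in> H" using ij by (auto simp: H_def)
    next
      fix p assume "p \<in> H"
      then obtain i j where ij: "i \<in> {k+2..n}" "j \<in> {k+2..n}" "i < j" "b j < b i" "p = (i, j)"
        by (auto simp: H_def)
      then have dom: "i - ?d \<in> {1..n-k-1}" "j - ?d \<in> {1..n-k-1}" "i - ?d + ?d = i" "j - ?d + ?d = j"
        by auto
      have "unshift ?d b (j - ?d) < unshift ?d b (i - ?d)"
        using un[OF dom(1)] un[OF dom(2)] dom(3,4) ij(4) by simp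
      then have "(i - ?d, j - ?d) \<in> ?I"
        using dom ij(3) by (simp add: inversions_def)
      then have "?g (i - ?d, j - ?d) \<in> ?g ` ?I" by (rule imageI)
      then show "p \<in> ?g ` ?I" using dom(3,4) ij(5) by simp
    qed
    ultimately show ?thesis using card_image by metis
  qed
  ultimately show ?thesis by (simp add: inv_count_eq_card)
qed

lemma unshift_permutes:
  assumes "b permutes {d+1..n}"
  shows "unshift d b permutes {1..n-d}"
proof (rule permutesI_inj_on)
  have b: "b (i + d) \<in> {d+1..n}" if "i \<in> {1..n-d}" for i
    using permutes_in_image[OF assms, of "i + d"] that by auto
  show "unshift d b ` {1..n-d} \<subseteq> {1..n-d}" using b by (force simp: unshift_def)
  show "inj_on (unshift d b) {1..n-d}"
  proof (rule inj_onI)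
    fix i j assume ij: "i \<in> {1..n-d}" "j \<in> {1..n-d}" "unshift d b i = unshift d b j"
    then have "b (i + d) = b (j + d)" using b[of i] b[of j] by (auto simp: unshift_def)
    then show "i = j" using injD[OF permutes_inj[OF assms]] by fastforce
  qed
  show "unshift d b i = i" if "i \<notin> {1..n-d}" for i
    using that permutes_not_in[OF assms, of "i + d"] by (auto simp: unshift_def)
qed simp

section \<open>The weight of a permutation\<close>

text \<open>The recursion of the weight and the decomposition of the inversions run in parallel: the new
  factor supplies \<open>k\<close>, and the three recursive weights supply the inversion numbers of
  \<open>u_perm (n - 1) k (\<lambda>i. lam i - 1)\<close>, \<open>a\<close> and \<open>b\<close>, unaffected by the powers of \<open>phi\<close>.\<close>

lemma weight_form_wt:
  "w permutes {1..n} \<Longrightarrow> weight_form (inv_count n w) (inv_count n w) (wt n w)"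
proof (induction n arbitrary: w rule: less_induct)
  case (less n)
  note w = less.prems
  show ?case
  proof (cases "n \<le> 1")
    case True
    then have "inversions n w = {}" by (auto simp: inversions_def)
    then have "inv_count n w = 0" by (simp add: inv_count_eq_card)
    then show ?thesis using True w by (simp add: wt.simps[of n w] weight_form.one)
  next
    case False
    define k where "k = inv w 1 - 1"
    have "inv w 1 \<in> {1..n}" using permutes_in_image[OF permutes_inv[OF w], of 1] False by simp
    then have "k < n" "k + 1 = inv w 1" by (auto simp: k_def)
    then have wk: "w (k + 1) = 1" by (simp only: permutes_inverses(1)[OF w])
    obtain lam a b where fac: "factors n k w (lam, a, b)" and u1: "u_perm n k lam (k + 1) = 1"
      using factors_exist[OF w \<open>k < n\<close> wk] .
    have lam: "partition_in_rect k (n - k) lam" and a: "a permutes {1..k}"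
      and b: "b permutes {k+2..n}" and w_eq: "w = u_perm n k lam \<circ> a \<circ> b"
      using fac by (auto simp: factors_def)
    define u' where "u' = u_perm (n - 1) k (\<lambda>i. lam i - 1)"
    define b' where "b' = unshift (k + 1) b"
    have u'_eq: "u' = delete_value_one k (u_perm n k lam)"
      unfolding u'_def by (rule u_perm_delete_value_one(2)[OF lam \<open>k < n\<close> u1])
    have u'_grass: "grassmannian (n - 1) k u'"
      unfolding u'_eq by (rule u_perm_delete_value_one(1)[OF lam \<open>k < n\<close> u1])
    have b': "b' permutes {1..n-k-1}"
      using unshift_permutes[of b "k + 1" n] b by (simp add: b'_def)
    have the: "(THE f. factors n k w f) = (lam, a, b)"
    proof (rule the_equality[where P = "factors n k w", OF fac])
      fix f assume f: "factors n k w f"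
      obtain lam' a' b' where f_eq: "f = (lam', a', b')" by (rule prod_cases3)
      show "f = (lam, a, b)"
        unfolding f_eq by (rule factors_unique[OF \<open>k < n\<close> f[unfolded f_eq] fac])
    qed
    have wt: "wt n w = (T (int k) / T 0) * (phi (qtfact k) / qtfact k) * phi (wt (n - 1) u')
        * wt k a * (phi ^^ (k + 1)) (wt (n - k - 1) b')"
      unfolding wt.simps[of n w] using w False the
      by (simp only: Let_def k_def[symmetric] u'_def b'_def) simp
    have count: "inv_count n w =
        k + inv_count (n - 1) u' + inv_count k a + inv_count (n - k - 1) b'"
      using inv_count_decomposition[OF u_perm_grassmannian(1)[OF lam less_imp_le[OF \<open>k < n\<close>]]
          u1 \<open>k < n\<close> u'_grass[unfolded u'_eq] a b]
      by (simp only: w_eq u'_eq b'_def)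
    have "weight_form (inv_count (n - 1) u') (inv_count (n - 1) u') (wt (n - 1) u')"
      "weight_form (inv_count k a) (inv_count k a) (wt k a)"
      "weight_form (inv_count (n - k - 1) b') (inv_count (n - k - 1) b') (wt (n - k - 1) b')"
      using u'_grass a b' \<open>k < n\<close> by (auto intro!: less.IH simp: grassmannian_def)
    then show ?thesis
      unfolding wt count
      by (intro weight_form_mult weight_form_step weight_form_phi weight_form_phi_funpow)
  qed
qed

theorem proposition8p3:
  fixes n :: nat and w :: "nat \<Rightarrow> nat"
  assumes "w permutes {1..n}"
  shows
    "(\<forall>q\<ge>2.
        (\<exists>P :: rat poly.
            specializes q (wt n w) (poly (map_poly of_rat P) tvar) \<and>
            (\<forall>i. coeff P i \<ge> 0) \<and>
            (\<exists>(x :: nat) (y :: nat \<Rightarrow> nat) (z :: nat \<Rightarrow> nat).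
                (\<forall>i\<in>{1..inv_count n w}. y i > z i) \<and>
                P = monom 1 x * (\<Prod>i=1..inv_count n w. qint q (monom 1 (q ^ y i - q ^ z i))))) \<and>
        lim_t1 q (wt n w) (of_nat q ^ inv_count n w)) \<and>
     lim_q1 (wt n w) (qt_var ^ inv_count n w)"
proof (intro conjI allI impI)
  note form = weight_form_wt[OF assms]
  show "lim_q1 (wt n w) (qt_var ^ inv_count n w)"
    by (rule lim_q1_weight_form[OF form])
  fix q :: nat assume q: "2 \<le> q"
  obtain x y z where yz: "\<forall>i\<in>{1..inv_count n w}. z i < y i"
    and spec: "specializes q (wt n w)
      (at_tvar (monom 1 x * (\<Prod>i=1..inv_count n w. qint q (monom 1 (q ^ y i - q ^ z i)))))"
    using specializes_weight_form[OF q form] by (auto simp del: One_nat_def)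
  define P :: "rat poly" where
    "P = monom 1 x * (\<Prod>i=1..inv_count n w. qint q (monom 1 (q ^ y i - q ^ z i)))"
  have "\<forall>i. 0 \<le> coeff P i"
    unfolding P_def
    by (intro nonneg_coeff_mult nonneg_coeff_prod nonneg_coeff_qint_monom) simp
  then show "\<exists>P :: rat poly.
      specializes q (wt n w) (poly (map_poly of_rat P) tvar) \<and>
      (\<forall>i. coeff P i \<ge> 0) \<and>
      (\<exists>(x :: nat) (y :: nat \<Rightarrow> nat) (z :: nat \<Rightarrow> nat).
          (\<forall>i\<in>{1..inv_count n w}. y i > z i) \<and>
          P = monom 1 x * (\<Prod>i=1..inv_count n w. qint q (monom 1 (q ^ y i - q ^ z i))))"
    using spec yz unfolding P_def at_tvar_def by blast
  have "poly P 1 = of_nat q ^ inv_count n w"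
    by (simp add: P_def poly_prod qint_def poly_sum poly_monom)
  then show "lim_t1 q (wt n w) (of_nat q ^ inv_count n w)"
    using spec ratsubst_at_tvar_1[of P] unfolding lim_t1_def P_def[symmetric] by auto
qed

end
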